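(* Let $n\ge1$ and let $(\mathcal{A},\varphi)$ be a $*$-non-commutative probability space, where $\mathcal{A}$ is a unital $*$-algebra containing elements $\{v_{i,j}:1\le i,j\le n\}$ whose joint $*$-distribution with respect to $\varphi$ is that of the canonical generators of the Brown algebra $U_n^{\mathrm{nc}}$ and for which the matrix $v=(v_{i,j})_{i,j=1}^n\in M_n(\mathcal{A})$ is unitary, together with a $*$-subalgebra $\mathcal{B}$ that is free from $\{v_{i,j}:1\le i,j\le n\}$. Then $v$ is free from $M_n(\mathcal{B})$ with respect to $\Phi=\varphi\circ\mathrm{tr}$, i.e. $\Phi((a_{ij}))=\frac1n\sum_{i=1}^n\varphi(a_{ii})$ on $M_n(\mathcal{A})$.
   Context: **Brown algebra and its generators.** Let $M_n(\mathbb{C})*C(\mathbb{T})$ be the (unital) free product $C^*$-algebra, with tracial state $\varphi_n$ equal to the free product of the normalized trace on $M_n(\mathbb{C})$ and integration against normalized Haar measure on $C(\mathbb{T})$. Let $\{e_{ij}\}$ be the matrix units of $M_n(\mathbb{C})$ and $v(z)=z$ in $C(\mathbb{T})$. The Brown algebra is $U_n^{\mathrm{nc}}=e_{11}(M_n(\mathbb{C})*C(\mathbb{T}))e_{11}$, with canonical generators $v_{ij}=e_{1i}\,v\,e_{j1}$ and tracial state $x\mapsto n\,\varphi_n(x)$. Freeness is meant in the $*$-sense: two sets are free if the unital $*$-algebras they generate are free; "$v$ is free from $M_n(\mathcal{B})$" refers to the unital $*$-algebra generated by $v$ (i.e. by $v$ and $v^*$) in $M_n(\mathcal{A})$. *)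

theory Defs
  imports
    "HOL-Analysis.Analysis"
    "HOL-Algebra.Module"
    "HOL-Library.Poly_Mapping"
begin

section \<open>Unital \<open>*\<close>-algebras over the complex numbers\<close>

record 'a star_algebra = "(complex, 'a) module" +
  adj :: "'a \<Rightarrow> 'a"

definition complex_alg :: "complex star_algebra" where
  "complex_alg = \<lparr>carrier = UNIV, mult = (*), one = 1, zero = 0, add = (+), smult = (*), adj = cnj\<rparr>"

text \<open>\<^const>\<open>complex_alg\<close> doubles as the ring of scalars of every \<open>*\<close>-algebra.
  The library locale \<open>algebra\<close> cannot be used here, since it is restricted to commutative algebras.\<close>

locale star_algebra = ring A + module complex_alg A
  for A :: "('a, 'm) star_algebra_scheme" (structure) +
  assumes smult_mult_left:
      "\<lbrakk>x \<in> carrier A; y \<in> carrier A\<rbrakk> \<Longrightarrow> (c \<odot> x) \<otimes> y = c \<odot> (x \<otimes> y)"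
    and smult_mult_right:
      "\<lbrakk>x \<in> carrier A; y \<in> carrier A\<rbrakk> \<Longrightarrow> x \<otimes> (c \<odot> y) = c \<odot> (x \<otimes> y)"
    and adj_closed: "x \<in> carrier A \<Longrightarrow> adj A x \<in> carrier A"
    and adj_adj: "x \<in> carrier A \<Longrightarrow> adj A (adj A x) = x"
    and adj_add:
      "\<lbrakk>x \<in> carrier A; y \<in> carrier A\<rbrakk> \<Longrightarrow> adj A (x \<oplus> y) = adj A x \<oplus> adj A y"
    and adj_mult:
      "\<lbrakk>x \<in> carrier A; y \<in> carrier A\<rbrakk> \<Longrightarrow> adj A (x \<otimes> y) = adj A y \<otimes> adj A x"
    and adj_smult: "x \<in> carrier A \<Longrightarrow> adj A (c \<odot> x) = cnj c \<odot> adj A x"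

definition star_subalgebra ::
    "'a set \<Rightarrow> ('a, 'm) star_algebra_scheme \<Rightarrow> bool" where
  "star_subalgebra S A \<longleftrightarrow> S \<subseteq> carrier A \<and> \<zero>\<^bsub>A\<^esub> \<in> S \<and>
     (\<forall>x\<in>S. \<forall>y\<in>S. x \<oplus>\<^bsub>A\<^esub> y \<in> S \<and> x \<otimes>\<^bsub>A\<^esub> y \<in> S) \<and>
     (\<forall>x\<in>S. adj A x \<in> S \<and> (\<forall>c. c \<odot>\<^bsub>A\<^esub> x \<in> S))"

definition generated_star_algebra ::
    "('a, 'm) star_algebra_scheme \<Rightarrow> 'a set \<Rightarrow> 'a set" where
  "generated_star_algebra A S = (\<lambda>T. star_subalgebra T A \<and> \<one>\<^bsub>A\<^esub> \<in> T) hull S"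

text \<open>Homomorphisms are unital: \<^const>\<open>ring_hom\<close> includes preservation of the unit.\<close>

definition star_hom ::
    "('a, 'm) star_algebra_scheme \<Rightarrow> ('b, 'k) star_algebra_scheme \<Rightarrow> ('a \<Rightarrow> 'b) set" where
  "star_hom A B = {h \<in> ring_hom A B.
     (\<forall>x\<in>carrier A. h (adj A x) = adj B (h x) \<and> (\<forall>c. h (c \<odot>\<^bsub>A\<^esub> x) = c \<odot>\<^bsub>B\<^esub> h x))}"

definition unitary_elements :: "('a, 'm) star_algebra_scheme \<Rightarrow> 'a set" where
  "unitary_elements A =
     {u \<in> carrier A. adj A u \<otimes>\<^bsub>A\<^esub> u = \<one>\<^bsub>A\<^esub> \<and> u \<otimes>\<^bsub>A\<^esub> adj A u = \<one>\<^bsub>A\<^esub>}"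

section \<open>Non-commutative probability\<close>

locale star_prob_space = star_algebra A
  for A :: "('a, 'm) star_algebra_scheme" (structure) +
  fixes \<phi> :: "'a \<Rightarrow> complex"
  assumes state_add:
      "\<lbrakk>x \<in> carrier A; y \<in> carrier A\<rbrakk> \<Longrightarrow> \<phi> (x \<oplus> y) = \<phi> x + \<phi> y"
    and state_smult: "x \<in> carrier A \<Longrightarrow> \<phi> (c \<odot> x) = c * \<phi> x"
    and state_one: "\<phi> \<one> = 1"
    and state_positive: "x \<in> carrier A \<Longrightarrow> \<phi> (adj A x \<otimes> x) \<in> \<real>\<^sub>\<ge>\<^sub>0"

definition alg_prod :: "('a, 'm) star_algebra_scheme \<Rightarrow> 'a list \<Rightarrow> 'a" where
  "alg_prod A xs = foldr (\<otimes>\<^bsub>A\<^esub>) xs \<one>\<^bsub>A\<^esub>"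

text \<open>Freeness of two sets. In the list \<open>ws\<close> an entry \<open>(False, x)\<close> is a factor from the
  algebra generated by \<open>S\<close>, and \<open>(True, x)\<close> one from the algebra generated by \<open>T\<close>.\<close>

definition star_free ::
    "('a, 'm) star_algebra_scheme \<Rightarrow> ('a \<Rightarrow> complex) \<Rightarrow> 'a set \<Rightarrow> 'a set \<Rightarrow> bool" where
  "star_free A \<phi> S T \<longleftrightarrow>
     (\<forall>ws :: (bool \<times> 'a) list.
        ws \<noteq> [] \<and> distinct_adj (map fst ws) \<and>
        (\<forall>(b, x)\<in>set ws. x \<in> generated_star_algebra A (if b then T else S) \<and> \<phi> x = 0) \<longrightarrow>
        \<phi> (alg_prod A (map snd ws)) = 0)"

text \<open>Non-commutative \<open>*\<close>-polynomials in variables indexed by \<open>I\<close>: finitely supported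
  coefficient functions on words, where the letter \<open>(i, False)\<close> is the variable \<open>X\<^sub>i\<close> and
  \<open>(i, True)\<close> its adjoint. The joint \<open>*\<close>-distribution of a family is the induced functional
  on these polynomials.\<close>

type_synonym 'i star_polynomial = "('i \<times> bool) list \<Rightarrow>\<^sub>0 complex"

definition star_polynomials :: "'i set \<Rightarrow> 'i star_polynomial set" where
  "star_polynomials I = {p. Poly_Mapping.keys p \<subseteq> lists (I \<times> UNIV)}"

definition eval_star_polynomial ::
    "('a, 'm) star_algebra_scheme \<Rightarrow> ('i \<Rightarrow> 'a) \<Rightarrow> 'i star_polynomial \<Rightarrow> 'a" where
  "eval_star_polynomial A x p =
     (\<Oplus>\<^bsub>A\<^esub>w\<in>Poly_Mapping.keys p. Poly_Mapping.lookup p w \<odot>\<^bsub>A\<^esub>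
        alg_prod A (map (\<lambda>(i, b). if b then adj A (x i) else x i) w))"

definition star_distribution ::
    "('a, 'm) star_algebra_scheme \<Rightarrow> ('a \<Rightarrow> complex) \<Rightarrow> 'i set \<Rightarrow> ('i \<Rightarrow> 'a) \<Rightarrow>
      'i star_polynomial \<Rightarrow> complex" where
  "star_distribution A \<phi> I x =
     restrict (\<lambda>p. \<phi> (eval_star_polynomial A x p)) (star_polynomials I)"

section \<open>Matrices over a \<open>*\<close>-algebra\<close>

abbreviation mat_indices :: "nat \<Rightarrow> (nat \<times> nat) set" where
  "mat_indices n \<equiv> {1..n} \<times> {1..n}"

definition mat_alg ::
    "nat \<Rightarrow> ('a, 'm) star_algebra_scheme \<Rightarrow> (nat \<times> nat \<Rightarrow> 'a) star_algebra" where
  "mat_alg n A =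
    \<lparr>carrier = mat_indices n \<rightarrow>\<^sub>E carrier A,
     mult = (\<lambda>M N. restrict (\<lambda>(i, j). \<Oplus>\<^bsub>A\<^esub>k\<in>{1..n}. M (i, k) \<otimes>\<^bsub>A\<^esub> N (k, j)) (mat_indices n)),
     one = restrict (\<lambda>(i, j). if i = j then \<one>\<^bsub>A\<^esub> else \<zero>\<^bsub>A\<^esub>) (mat_indices n),
     zero = restrict (\<lambda>_. \<zero>\<^bsub>A\<^esub>) (mat_indices n),
     add = (\<lambda>M N. restrict (\<lambda>p. M p \<oplus>\<^bsub>A\<^esub> N p) (mat_indices n)),
     smult = (\<lambda>c M. restrict (\<lambda>p. c \<odot>\<^bsub>A\<^esub> M p) (mat_indices n)),
     adj = (\<lambda>M. restrict (\<lambda>(i, j). adj A (M (j, i))) (mat_indices n))\<rparr>"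

definition mat_unit ::
    "nat \<Rightarrow> ('a, 'm) star_algebra_scheme \<Rightarrow> nat \<Rightarrow> nat \<Rightarrow> nat \<times> nat \<Rightarrow> 'a" where
  "mat_unit n A i j = restrict (\<lambda>p. if p = (i, j) then \<one>\<^bsub>A\<^esub> else \<zero>\<^bsub>A\<^esub>) (mat_indices n)"

definition mat_state :: "nat \<Rightarrow> ('a \<Rightarrow> complex) \<Rightarrow> (nat \<times> nat \<Rightarrow> 'a) \<Rightarrow> complex" where
  "mat_state n \<phi> M = (\<Sum>i=1..n. \<phi> (M (i, i))) / of_nat n"

section \<open>Continuous functions on the circle\<close>

abbreviation circle :: "complex set" where
  "circle \<equiv> sphere 0 1"

definition circle_alg :: "(complex \<Rightarrow> complex) star_algebra" where
  "circle_alg =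
    \<lparr>carrier = {f \<in> extensional circle. continuous_on circle f},
     mult = (\<lambda>f g. restrict (\<lambda>z. f z * g z) circle),
     one = restrict (\<lambda>_. 1) circle,
     zero = restrict (\<lambda>_. 0) circle,
     add = (\<lambda>f g. restrict (\<lambda>z. f z + g z) circle),
     smult = (\<lambda>c f. restrict (\<lambda>z. c * f z) circle),
     adj = (\<lambda>f. restrict (\<lambda>z. cnj (f z)) circle)\<rparr>"

text \<open>Normalized Haar measure on the circle is normalized arc length.\<close>

definition circle_state :: "(complex \<Rightarrow> complex) \<Rightarrow> complex" where
  "circle_state f = integral {0..2 * pi} (\<lambda>t. f (cis t)) / of_real (2 * pi)"

definition circle_id :: "complex \<Rightarrow> complex" where
  "circle_id = restrict (\<lambda>z. z) circle"

section \<open>\<open>C\<^sup>*\<close>-algebras and their unital free products\<close>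

record 'a cstar_algebra = "'a star_algebra" +
  cnorm :: "'a \<Rightarrow> real"

locale cstar_algebra = star_algebra A
  for A :: "('a, 'm) cstar_algebra_scheme" (structure) +
  assumes cnorm_nonneg: "x \<in> carrier A \<Longrightarrow> 0 \<le> cnorm A x"
    and cnorm_eq_0_iff: "x \<in> carrier A \<Longrightarrow> cnorm A x = 0 \<longleftrightarrow> x = \<zero>"
    and cnorm_triangle:
      "\<lbrakk>x \<in> carrier A; y \<in> carrier A\<rbrakk> \<Longrightarrow> cnorm A (x \<oplus> y) \<le> cnorm A x + cnorm A y"
    and cnorm_smult: "x \<in> carrier A \<Longrightarrow> cnorm A (c \<odot> x) = cmod c * cnorm A x"
    and cnorm_mult:
      "\<lbrakk>x \<in> carrier A; y \<in> carrier A\<rbrakk> \<Longrightarrow> cnorm A (x \<otimes> y) \<le> cnorm A x * cnorm A y"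
    and cstar_identity: "x \<in> carrier A \<Longrightarrow> cnorm A (adj A x \<otimes> x) = (cnorm A x)\<^sup>2"
    and cnorm_complete:
      "\<And>\<sigma>. \<lbrakk>range \<sigma> \<subseteq> carrier A;
         \<And>\<epsilon>. 0 < \<epsilon> \<Longrightarrow> \<exists>N. \<forall>m\<ge>N. \<forall>k\<ge>N. cnorm A (\<sigma> m \<ominus> \<sigma> k) < \<epsilon>\<rbrakk> \<Longrightarrow>
         \<exists>x\<in>carrier A. (\<lambda>m. cnorm A (\<sigma> m \<ominus> x)) \<longlonglongrightarrow> 0"

text \<open>The unital (full) free product of two unital \<open>C\<^sup>*\<close>-algebras, as a \<open>C\<^sup>*\<close>-algebra \<open>C\<close>
  together with the two canonical homomorphisms, characterized by its universal property.

  The norms of \<open>A\<^sub>1\<close> and \<open>A\<^sub>2\<close> do not occur, because \<open>*\<close>-homomorphisms between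
  \<open>C\<^sup>*\<close>-algebras are automatically contractive and the norm of a \<open>C\<^sup>*\<close>-algebra is determined
  by its \<open>*\<close>-algebra structure.

  HOL cannot quantify over the type that carries the test algebra \<open>D\<close>, so \<open>D\<close> ranges over
  the \<open>C\<^sup>*\<close>-algebras carried by subsets of \<open>'c\<close>. For nontrivial \<open>C\<close> and separable
  \<open>A\<^sub>1\<close>, \<open>A\<^sub>2\<close> this is no restriction: \<open>C\<close> is a nonzero complex vector space, so \<open>'c\<close> has at least
  the cardinality of the continuum, whereas the images of \<open>A\<^sub>1\<close> and \<open>A\<^sub>2\<close> in any \<open>C\<^sup>*\<close>-algebra
  generate a separable subalgebra, of cardinality at most the continuum.\<close>

definition cstar_free_product ::
    "('a, 'm) star_algebra_scheme \<Rightarrow> ('b, 'k) star_algebra_scheme \<Rightarrow> 'c cstar_algebra \<Rightarrow>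
      ('a \<Rightarrow> 'c) \<Rightarrow> ('b \<Rightarrow> 'c) \<Rightarrow> bool" where
  "cstar_free_product A\<^sub>1 A\<^sub>2 C \<iota>\<^sub>1 \<iota>\<^sub>2 \<longleftrightarrow>
     cstar_algebra C \<and> \<iota>\<^sub>1 \<in> star_hom A\<^sub>1 C \<and> \<iota>\<^sub>2 \<in> star_hom A\<^sub>2 C \<and>
     (\<forall>(D :: 'c cstar_algebra) f\<^sub>1 f\<^sub>2.
        cstar_algebra D \<and> f\<^sub>1 \<in> star_hom A\<^sub>1 D \<and> f\<^sub>2 \<in> star_hom A\<^sub>2 D \<longrightarrow>
        (\<exists>!h. h \<in> star_hom C D \<and> h \<in> extensional (carrier C) \<and>
           (\<forall>x\<in>carrier A\<^sub>1. h (\<iota>\<^sub>1 x) = f\<^sub>1 x) \<and> (\<forall>y\<in>carrier A\<^sub>2. h (\<iota>\<^sub>2 y) = f\<^sub>2 y)))"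

text \<open>The free product of the states \<open>\<phi>\<^sub>1\<close> and \<open>\<phi>\<^sub>2\<close> is the unique state that restricts to
  them and makes the images of the two algebras free. It is tracial when \<open>\<phi>\<^sub>1\<close> and \<open>\<phi>\<^sub>2\<close> are.\<close>

definition free_product_state ::
    "('a, 'm) star_algebra_scheme \<Rightarrow> ('a \<Rightarrow> complex) \<Rightarrow>
      ('b, 'k) star_algebra_scheme \<Rightarrow> ('b \<Rightarrow> complex) \<Rightarrow>
      ('c, 'l) star_algebra_scheme \<Rightarrow> ('a \<Rightarrow> 'c) \<Rightarrow> ('b \<Rightarrow> 'c) \<Rightarrow> ('c \<Rightarrow> complex) \<Rightarrow> bool" where
  "free_product_state A\<^sub>1 \<phi>\<^sub>1 A\<^sub>2 \<phi>\<^sub>2 C \<iota>\<^sub>1 \<iota>\<^sub>2 \<phi> \<longleftrightarrow>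
     star_prob_space C \<phi> \<and>
     (\<forall>x\<in>carrier A\<^sub>1. \<phi> (\<iota>\<^sub>1 x) = \<phi>\<^sub>1 x) \<and> (\<forall>y\<in>carrier A\<^sub>2. \<phi> (\<iota>\<^sub>2 y) = \<phi>\<^sub>2 y) \<and>
     star_free C \<phi> (\<iota>\<^sub>1 ` carrier A\<^sub>1) (\<iota>\<^sub>2 ` carrier A\<^sub>2)"

section \<open>The Brown algebra\<close>

definition corner ::
    "('a, 'm) star_algebra_scheme \<Rightarrow> 'a \<Rightarrow> ('a, 'm) star_algebra_scheme" where
  "corner A e = A\<lparr>carrier := {e \<otimes>\<^bsub>A\<^esub> x \<otimes>\<^bsub>A\<^esub> e | x. x \<in> carrier A}, one := e\<rparr>"

text \<open>Here \<open>C\<close> is the free product of \<open>M\<^sub>n(\<complex>)\<close> and \<open>C(\<bbbT>)\<close>, with canonical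
  homomorphisms \<open>\<iota>\<close> and \<open>\<kappa>\<close>.\<close>

definition brown_algebra ::
    "nat \<Rightarrow> ('c, 'm) star_algebra_scheme \<Rightarrow> ((nat \<times> nat \<Rightarrow> complex) \<Rightarrow> 'c) \<Rightarrow>
      ('c, 'm) star_algebra_scheme" where
  "brown_algebra n C \<iota> = corner C (\<iota> (mat_unit n complex_alg 1 1))"

definition brown_generator ::
    "nat \<Rightarrow> ('c, 'm) star_algebra_scheme \<Rightarrow> ((nat \<times> nat \<Rightarrow> complex) \<Rightarrow> 'c) \<Rightarrow>
      ((complex \<Rightarrow> complex) \<Rightarrow> 'c) \<Rightarrow> nat \<times> nat \<Rightarrow> 'c" where
  "brown_generator n C \<iota> \<kappa> = (\<lambda>(i, j).
     \<iota> (mat_unit n complex_alg 1 i) \<otimes>\<^bsub>C\<^esub> \<kappa> circle_id \<otimes>\<^bsub>C\<^esub> \<iota> (mat_unit n complex_alg j 1))"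

definition brown_state :: "nat \<Rightarrow> ('c \<Rightarrow> complex) \<Rightarrow> 'c \<Rightarrow> complex" where
  "brown_state n \<phi> x = of_nat n * \<phi> x"

end

theory Submission
  imports Defs
begin

text \<open>
  Freeness of \<open>v\<close> from \<open>M\<^sub>n(B)\<close> says that \<open>\<Phi>\<close> vanishes on alternating products of
  \<open>\<Phi>\<close>-centred elements \<open>x\<close> of the algebra generated by \<open>v\<close> and \<open>\<Phi>\<close>-centred elements \<open>b\<close> of
  the algebra generated by \<open>M\<^sub>n(B)\<close>. Every such \<open>b\<close> splits as \<open>b' + m\<close>, where the entries of
  \<open>b'\<close> are centred for \<open>\<phi>\<close> and lie in the algebra generated by \<open>B\<close>, and \<open>m\<close> is the scalar
  matrix with entries \<open>\<phi>(b\<^sub>i\<^sub>j)\<close>; because \<open>\<Phi>(b) = 0\<close>, the trace of \<open>m\<close> is zero.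
  Expanding all the \<open>b\<close> turns the product into a sum of products in which matrices \<open>b'\<close>
  alternate with runs \<open>x\<^sub>1 m\<^sub>1 x\<^sub>2 \<dots> m\<^sub>k\<^sub>-\<^sub>1 x\<^sub>k\<close>, except that a scalar matrix may also
  stand at either end.

  The key fact (\<open>runs_entry\<close>) is that the entries of a run are \<open>\<phi>\<close>-centred elements of the
  algebra generated by the \<open>v\<^sub>i\<^sub>j\<close>. Given this, every entry of such a product is a
  combination of alternating products of centred elements of two free subalgebras of \<open>A\<close>,
  so \<open>\<phi>\<close> annihilates it; the only remaining products are trace-zero scalar matrices.

  The key fact is computed in the free product \<open>C\<close> of \<open>M\<^sub>n(\<complex>)\<close> and \<open>C(\<bbbT>)\<close>. Write \<open>w\<close> for
  the generator of \<open>C(\<bbbT>)\<close>. The entries \<open>v\<^sub>i\<^sub>j\<close> are distributed as \<open>e\<^sub>1\<^sub>i w e\<^sub>j\<^sub>1\<close>, and the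
  assignment \<open>y \<mapsto> (e\<^sub>1\<^sub>i y e\<^sub>j\<^sub>1)\<^sub>i\<^sub>j\<close> is a unital \<open>*\<close>-homomorphism, since
  \<open>\<Sum>\<^sub>k e\<^sub>k\<^sub>1 e\<^sub>1\<^sub>k = 1\<close>. So a polynomial \<open>x\<close> in \<open>v\<close> is modelled by the same polynomial \<open>y\<close> in
  \<open>w\<close>, a scalar matrix is modelled by its image in \<open>C\<close>, and the \<open>(i, j)\<close> entry of a run
  has expectation \<open>n \<phi>\<^sub>n(e\<^sub>1\<^sub>i y\<^sub>1 m\<^sub>1 y\<^sub>2 \<dots> y\<^sub>k e\<^sub>j\<^sub>1)\<close>. Here all inner factors are centred
  (\<open>lifts_mat_state\<close> for the \<open>y\<^sub>l\<close>), and splitting the two outer matrix units into a centred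
  part and a scalar leaves alternating centred words only (\<open>state_sandwich_word\<close>), on which
  \<open>\<phi>\<^sub>n\<close> vanishes by freeness.
\<close>

section \<open>Unital \<open>*\<close>-algebras\<close>

\<comment> \<open>Matrix indices range over \<open>{1..n}\<close>; rewriting the bound to \<open>Suc 0\<close> would keep the
  entry rules below from matching.\<close>
declare One_nat_def [simp del]

lemma complex_alg_simps [simp]:
  "carrier complex_alg = UNIV" "mult complex_alg = (*)" "one complex_alg = 1"
  "zero complex_alg = 0" "add complex_alg = (+)" "smult complex_alg = (*)" "adj complex_alg = cnj"
  by (simp_all add: complex_alg_def)

lemma cring_complex_alg: "cring complex_alg"
proof (rule cringI)
  show "abelian_group complex_alg"
    by (rule abelian_groupI) (auto intro: exI[of _ "- _"] left_minus)
  show "comm_monoid complex_alg"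
    by (rule comm_monoidI) auto
qed (simp add: distrib_right)

lemma star_algebraI:
  fixes A :: "('a, 'm) star_algebra_scheme" (structure)
  assumes "\<And>x y. \<lbrakk>x \<in> carrier A; y \<in> carrier A\<rbrakk> \<Longrightarrow> x \<oplus> y \<in> carrier A"
    and "\<zero> \<in> carrier A"
    and "\<And>x y z. \<lbrakk>x \<in> carrier A; y \<in> carrier A; z \<in> carrier A\<rbrakk> \<Longrightarrow> (x \<oplus> y) \<oplus> z = x \<oplus> (y \<oplus> z)"
    and "\<And>x y. \<lbrakk>x \<in> carrier A; y \<in> carrier A\<rbrakk> \<Longrightarrow> x \<oplus> y = y \<oplus> x"
    and "\<And>x. x \<in> carrier A \<Longrightarrow> \<zero> \<oplus> x = x"
    and "\<And>x. x \<in> carrier A \<Longrightarrow> ((-1) \<odot> x) \<oplus> x = \<zero>"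
    and "\<And>x y. \<lbrakk>x \<in> carrier A; y \<in> carrier A\<rbrakk> \<Longrightarrow> x \<otimes> y \<in> carrier A"
    and "\<one> \<in> carrier A"
    and "\<And>x y z. \<lbrakk>x \<in> carrier A; y \<in> carrier A; z \<in> carrier A\<rbrakk> \<Longrightarrow> (x \<otimes> y) \<otimes> z = x \<otimes> (y \<otimes> z)"
    and "\<And>x. x \<in> carrier A \<Longrightarrow> \<one> \<otimes> x = x"
    and "\<And>x. x \<in> carrier A \<Longrightarrow> x \<otimes> \<one> = x"
    and "\<And>x y z. \<lbrakk>x \<in> carrier A; y \<in> carrier A; z \<in> carrier A\<rbrakk> \<Longrightarrow> (x \<oplus> y) \<otimes> z = x \<otimes> z \<oplus> y \<otimes> z"
    and "\<And>x y z. \<lbrakk>x \<in> carrier A; y \<in> carrier A; z \<in> carrier A\<rbrakk> \<Longrightarrow> z \<otimes> (x \<oplus> y) = z \<otimes> x \<oplus> z \<otimes> y"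
    and smult: "\<And>c x. x \<in> carrier A \<Longrightarrow> c \<odot> x \<in> carrier A"
    and "\<And>c d x. x \<in> carrier A \<Longrightarrow> (c + d) \<odot> x = c \<odot> x \<oplus> d \<odot> x"
    and "\<And>c x y. \<lbrakk>x \<in> carrier A; y \<in> carrier A\<rbrakk> \<Longrightarrow> c \<odot> (x \<oplus> y) = c \<odot> x \<oplus> c \<odot> y"
    and "\<And>c d x. x \<in> carrier A \<Longrightarrow> (c * d) \<odot> x = c \<odot> (d \<odot> x)"
    and "\<And>x. x \<in> carrier A \<Longrightarrow> 1 \<odot> x = x"
    and "\<And>c x y. \<lbrakk>x \<in> carrier A; y \<in> carrier A\<rbrakk> \<Longrightarrow> (c \<odot> x) \<otimes> y = c \<odot> (x \<otimes> y)"
    and "\<And>c x y. \<lbrakk>x \<in> carrier A; y \<in> carrier A\<rbrakk> \<Longrightarrow> x \<otimes> (c \<odot> y) = c \<odot> (x \<otimes> y)"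
    and "\<And>x. x \<in> carrier A \<Longrightarrow> adj A x \<in> carrier A"
    and "\<And>x. x \<in> carrier A \<Longrightarrow> adj A (adj A x) = x"
    and "\<And>x y. \<lbrakk>x \<in> carrier A; y \<in> carrier A\<rbrakk> \<Longrightarrow> adj A (x \<oplus> y) = adj A x \<oplus> adj A y"
    and "\<And>x y. \<lbrakk>x \<in> carrier A; y \<in> carrier A\<rbrakk> \<Longrightarrow> adj A (x \<otimes> y) = adj A y \<otimes> adj A x"
    and "\<And>c x. x \<in> carrier A \<Longrightarrow> adj A (c \<odot> x) = cnj c \<odot> adj A x"
  shows "star_algebra A"
proof -
  have gr: "abelian_group A"
  proof (rule abelian_groupI)
    show "\<exists>y\<in>carrier A. y \<oplus> x = \<zero>" if "x \<in> carrier A" for x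
      using assms(6)[OF that] smult[OF that] by blast
  qed (rule assms; assumption)+
  have "ring A"
  proof (rule ringI[OF gr])
    show "Group.monoid A"
      by (rule monoidI; rule assms; assumption)
  qed (rule assms; assumption)+
  moreover have "Module.module complex_alg A"
    by (rule moduleI[OF cring_complex_alg gr]; unfold complex_alg_simps; rule assms; assumption)
  ultimately show ?thesis
    by (intro star_algebra.intro star_algebra_axioms.intro) (assumption | (rule assms; assumption))+
qed

lemma star_algebra_complex_alg: "star_algebra complex_alg"
  by (rule star_algebraI) (auto simp: algebra_simps)

lemma alg_prod_simps [simp]:
  "alg_prod A [] = \<one>\<^bsub>A\<^esub>" "alg_prod A (x # xs) = x \<otimes>\<^bsub>A\<^esub> alg_prod A xs"
  by (simp_all add: alg_prod_def)
context star_algebra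
begin

lemma is_semiring: "semiring A"
  by unfold_locales

text \<open>The ring of scalars is a second ring in this locale, and its facts shadow those of \<open>A\<close>
  under their unqualified names. The following declarations restore the facts about \<open>A\<close>.\<close>

lemmas a_closed = abelian_monoid.a_closed[OF semiring.axioms(1)[OF is_semiring]]
lemmas zero_closed = abelian_monoid.zero_closed[OF semiring.axioms(1)[OF is_semiring]]
lemmas a_assoc = abelian_monoid.a_assoc[OF semiring.axioms(1)[OF is_semiring]]
lemmas a_comm = abelian_monoid.a_comm[OF semiring.axioms(1)[OF is_semiring]]
lemmas l_zero = abelian_monoid.l_zero[OF semiring.axioms(1)[OF is_semiring]]
lemmas finsum_closed = abelian_monoid.finsum_closed[OF semiring.axioms(1)[OF is_semiring]]
lemmas finsum_cong' = abelian_monoid.finsum_cong'[OF semiring.axioms(1)[OF is_semiring]]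
lemmas finsum_addf = abelian_monoid.finsum_addf[OF semiring.axioms(1)[OF is_semiring]]
lemmas finsum_singleton = abelian_monoid.finsum_singleton[OF semiring.axioms(1)[OF is_semiring]]
lemmas m_closed = monoid.m_closed[OF semiring.axioms(2)[OF is_semiring]]
lemmas one_closed = monoid.one_closed[OF semiring.axioms(2)[OF is_semiring]]
lemmas m_assoc = monoid.m_assoc[OF semiring.axioms(2)[OF is_semiring]]
lemmas l_one = monoid.l_one[OF semiring.axioms(2)[OF is_semiring]]
lemmas r_one = monoid.r_one[OF semiring.axioms(2)[OF is_semiring]]
lemmas l_null = semiring.l_null[OF is_semiring]
lemmas r_null = semiring.r_null[OF is_semiring]
lemmas l_distr = semiring.l_distr[OF is_semiring]
lemmas r_distr = semiring.r_distr[OF is_semiring]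
lemmas finsum_ldistr = semiring.finsum_ldistr[OF is_semiring]
lemmas finsum_rdistr = semiring.finsum_rdistr[OF is_semiring]

lemma scaling:
  "x \<in> carrier A \<Longrightarrow> c \<odot> x \<in> carrier A"
  "x \<in> carrier A \<Longrightarrow> (c + d) \<odot> x = c \<odot> x \<oplus> d \<odot> x"
  "\<lbrakk>x \<in> carrier A; y \<in> carrier A\<rbrakk> \<Longrightarrow> c \<odot> (x \<oplus> y) = c \<odot> x \<oplus> c \<odot> y"
  "x \<in> carrier A \<Longrightarrow> (c * d) \<odot> x = c \<odot> (d \<odot> x)"
  "x \<in> carrier A \<Longrightarrow> 1 \<odot> x = x"
  "x \<in> carrier A \<Longrightarrow> 0 \<odot> x = \<zero>"
  "c \<odot> \<zero> = \<zero>"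
  using smult_closed[of c x] smult_l_distr[of c d x] smult_r_distr[of c x y] smult_assoc1[of c d x]
    smult_one[of x] smult_l_null[of x] smult_r_null[of c] by auto

lemmas algebra_closed = a_closed m_closed zero_closed one_closed scaling(1) adj_closed

lemma smult_minus_one:
  assumes "x \<in> carrier A"
  shows "((-1) \<odot> x) \<oplus> x = \<zero>"
  using scaling(2)[OF assms, of "-1" 1] scaling(5,6)[OF assms] by simp

lemma adj_zero: "adj A \<zero> = \<zero>"
  using adj_smult[of \<zero> 0] scaling(6)[of \<zero>] scaling(6)[of "adj A \<zero>"] adj_closed by simp

lemma adj_one: "adj A \<one> = \<one>"
  using adj_mult[of \<one> "adj A \<one>"] adj_closed[of \<one>] adj_adj[of \<one>] by simp

lemma adj_finsum:
  assumes "f \<in> S \<rightarrow> carrier A"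
  shows "adj A (finsum A f S) = (\<Oplus>i\<in>S. adj A (f i))"
  using assms
proof (induction S rule: infinite_finite_induct)
  case (insert i S)
  then have "f i \<in> carrier A" "f \<in> S \<rightarrow> carrier A" by auto
  with insert show ?case
    by (simp add: Pi_iff adj_closed adj_add)
qed (simp_all add: adj_zero)

lemma smult_finsum:
  assumes "f \<in> S \<rightarrow> carrier A"
  shows "c \<odot> finsum A f S = (\<Oplus>i\<in>S. c \<odot> f i)"
  using assms
proof (induction S rule: infinite_finite_induct)
  case (insert i S)
  then have "f i \<in> carrier A" "f \<in> S \<rightarrow> carrier A" by auto
  with insert show ?case
    by (simp add: Pi_iff scaling)
qed (simp_all add: scaling)

lemma finsum_swap:
  assumes "finite S" "finite T" "\<And>i j. \<lbrakk>i \<in> S; j \<in> T\<rbrakk> \<Longrightarrow> f i j \<in> carrier A"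
  shows "(\<Oplus>i\<in>S. \<Oplus>j\<in>T. f i j) = (\<Oplus>j\<in>T. \<Oplus>i\<in>S. f i j)"
  using assms(1,3)
proof (induction S rule: finite_induct)
  case (insert i S)
  then have "(\<Oplus>i\<in>insert i S. \<Oplus>j\<in>T. f i j) = (\<Oplus>j\<in>T. f i j) \<oplus> (\<Oplus>j\<in>T. \<Oplus>i\<in>S. f i j)"
    by (simp add: Pi_iff)
  also have "\<dots> = (\<Oplus>j\<in>T. f i j \<oplus> (\<Oplus>i\<in>S. f i j))"
    using insert.prems by (subst finsum_addf) (auto intro!: finsum_closed)
  also have "\<dots> = (\<Oplus>j\<in>T. \<Oplus>i\<in>insert i S. f i j)"
    using insert by (intro finsum_cong') (auto simp: Pi_iff)
  finally show ?case .
qed simp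

lemma alg_prod_closed: "set xs \<subseteq> carrier A \<Longrightarrow> alg_prod A xs \<in> carrier A"
  by (induction xs) auto

lemma alg_prod_append:
  "\<lbrakk>set xs \<subseteq> carrier A; set ys \<subseteq> carrier A\<rbrakk> \<Longrightarrow> alg_prod A (xs @ ys) = alg_prod A xs \<otimes> alg_prod A ys"
  by (induction xs) (auto simp: alg_prod_closed m_assoc)

lemma adj_alg_prod:
  "set xs \<subseteq> carrier A \<Longrightarrow> adj A (alg_prod A xs) = alg_prod A (rev (map (adj A) xs))"
proof (induction xs)
  case (Cons x xs)
  have "set (rev (map (adj A) xs)) \<subseteq> carrier A"
    using Cons.prems by (auto intro: adj_closed)
  with Cons show ?case
    by (simp add: alg_prod_append adj_mult alg_prod_closed adj_closed)
qed (simp add: adj_one)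

end

section \<open>Matrix algebras\<close>

text \<open>Matrices are extensional functions on index pairs. Calculations with them go through
  \<open>mat_eqI\<close> and the entry rules, so that the restrictions in the definitions are unfolded only
  once, here.\<close>
lemma mat_alg_simps:
  "carrier (mat_alg n A) = mat_indices n \<rightarrow>\<^sub>E carrier A"
  "mult (mat_alg n A) =
     (\<lambda>M N. restrict (\<lambda>(i, j). \<Oplus>\<^bsub>A\<^esub>k\<in>{1..n}. M (i, k) \<otimes>\<^bsub>A\<^esub> N (k, j)) (mat_indices n))"
  "one (mat_alg n A) = restrict (\<lambda>(i, j). if i = j then \<one>\<^bsub>A\<^esub> else \<zero>\<^bsub>A\<^esub>) (mat_indices n)"
  "zero (mat_alg n A) = restrict (\<lambda>_. \<zero>\<^bsub>A\<^esub>) (mat_indices n)"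
  "add (mat_alg n A) = (\<lambda>M N. restrict (\<lambda>p. M p \<oplus>\<^bsub>A\<^esub> N p) (mat_indices n))"
  "smult (mat_alg n A) = (\<lambda>c M. restrict (\<lambda>p. c \<odot>\<^bsub>A\<^esub> M p) (mat_indices n))"
  "adj (mat_alg n A) = (\<lambda>M. restrict (\<lambda>(i, j). adj A (M (j, i))) (mat_indices n))"
  by (simp_all add: mat_alg_def)

lemma mat_entry:
  assumes "i \<in> {1..n}" "j \<in> {1..n}"
  shows "(M \<otimes>\<^bsub>mat_alg n A\<^esub> N) (i, j) = (\<Oplus>\<^bsub>A\<^esub>k\<in>{1..n}. M (i, k) \<otimes>\<^bsub>A\<^esub> N (k, j))"
    and "\<one>\<^bsub>mat_alg n A\<^esub> (i, j) = (if i = j then \<one>\<^bsub>A\<^esub> else \<zero>\<^bsub>A\<^esub>)"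
    and "\<zero>\<^bsub>mat_alg n A\<^esub> (i, j) = \<zero>\<^bsub>A\<^esub>"
    and "(M \<oplus>\<^bsub>mat_alg n A\<^esub> N) (i, j) = M (i, j) \<oplus>\<^bsub>A\<^esub> N (i, j)"
    and "(c \<odot>\<^bsub>mat_alg n A\<^esub> M) (i, j) = c \<odot>\<^bsub>A\<^esub> M (i, j)"
    and "adj (mat_alg n A) M (i, j) = adj A (M (j, i))"
  using assms by (simp_all add: mat_alg_simps)

lemma mat_extensional:
  "M \<otimes>\<^bsub>mat_alg n A\<^esub> N \<in> extensional (mat_indices n)"
  "\<one>\<^bsub>mat_alg n A\<^esub> \<in> extensional (mat_indices n)"
  "\<zero>\<^bsub>mat_alg n A\<^esub> \<in> extensional (mat_indices n)"
  "M \<oplus>\<^bsub>mat_alg n A\<^esub> N \<in> extensional (mat_indices n)"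
  "c \<odot>\<^bsub>mat_alg n A\<^esub> M \<in> extensional (mat_indices n)"
  "adj (mat_alg n A) M \<in> extensional (mat_indices n)"
  "M \<in> carrier (mat_alg n A) \<Longrightarrow> M \<in> extensional (mat_indices n)"
  by (auto simp: mat_alg_simps PiE_def)

lemma mat_eqI:
  assumes "M \<in> extensional (mat_indices n)" "N \<in> extensional (mat_indices n)"
    and "\<And>i j. \<lbrakk>i \<in> {1..n}; j \<in> {1..n}\<rbrakk> \<Longrightarrow> M (i, j) = N (i, j)"
  shows "M = N"
  using assms by (intro extensionalityI[of M "mat_indices n" N]) auto

lemma mat_carrier_iff:
  "M \<in> carrier (mat_alg n A) \<longleftrightarrow>
     M \<in> extensional (mat_indices n) \<and> (\<forall>i\<in>{1..n}. \<forall>j\<in>{1..n}. M (i, j) \<in> carrier A)"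
  by (auto simp: mat_alg_simps PiE_def)

lemma mat_entry_closed:
  "\<lbrakk>M \<in> carrier (mat_alg n A); i \<in> {1..n}; j \<in> {1..n}\<rbrakk> \<Longrightarrow> M (i, j) \<in> carrier A"
  by (simp add: mat_carrier_iff)

context star_algebra
begin

lemma mat_mult_assoc:
  assumes M: "M \<in> carrier (mat_alg n A)" and N: "N \<in> carrier (mat_alg n A)"
    and P: "P \<in> carrier (mat_alg n A)"
  shows "(M \<otimes>\<^bsub>mat_alg n A\<^esub> N) \<otimes>\<^bsub>mat_alg n A\<^esub> P = M \<otimes>\<^bsub>mat_alg n A\<^esub> (N \<otimes>\<^bsub>mat_alg n A\<^esub> P)"
proof (rule mat_eqI[where n = n])
  fix i j assume ij: "i \<in> {1..n}" "j \<in> {1..n}"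
  note c = mat_entry_closed[OF M] mat_entry_closed[OF N] mat_entry_closed[OF P]
  have "((M \<otimes>\<^bsub>mat_alg n A\<^esub> N) \<otimes>\<^bsub>mat_alg n A\<^esub> P) (i, j)
      = (\<Oplus>l\<in>{1..n}. (\<Oplus>k\<in>{1..n}. M (i, k) \<otimes> N (k, l)) \<otimes> P (l, j))"
    using ij c by (simp only: mat_entry) (intro finsum_cong', auto simp: mat_entry)
  also have "\<dots> = (\<Oplus>l\<in>{1..n}. \<Oplus>k\<in>{1..n}. M (i, k) \<otimes> (N (k, l) \<otimes> P (l, j)))"
  proof (intro finsum_cong')
    fix l assume l: "l \<in> {1..n}"
    have "(\<Oplus>k\<in>{1..n}. M (i, k) \<otimes> N (k, l)) \<otimes> P (l, j)
        = (\<Oplus>k\<in>{1..n}. M (i, k) \<otimes> N (k, l) \<otimes> P (l, j))"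
      using ij l c by (intro finsum_ldistr) auto
    also have "\<dots> = (\<Oplus>k\<in>{1..n}. M (i, k) \<otimes> (N (k, l) \<otimes> P (l, j)))"
      using ij l c by (intro finsum_cong') (auto simp: m_assoc)
    finally show "(\<Oplus>k\<in>{1..n}. M (i, k) \<otimes> N (k, l)) \<otimes> P (l, j)
      = (\<Oplus>k\<in>{1..n}. M (i, k) \<otimes> (N (k, l) \<otimes> P (l, j)))" .
  qed (use ij c in \<open>auto intro!: finsum_closed\<close>)
  also have "\<dots> = (\<Oplus>k\<in>{1..n}. \<Oplus>l\<in>{1..n}. M (i, k) \<otimes> (N (k, l) \<otimes> P (l, j)))"
    using ij c by (intro finsum_swap) auto
  also have "\<dots> = (\<Oplus>k\<in>{1..n}. M (i, k) \<otimes> (\<Oplus>l\<in>{1..n}. N (k, l) \<otimes> P (l, j)))"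
    using ij c by (intro finsum_cong' finsum_rdistr[symmetric]) (auto intro!: finsum_closed)
  also have "\<dots> = (M \<otimes>\<^bsub>mat_alg n A\<^esub> (N \<otimes>\<^bsub>mat_alg n A\<^esub> P)) (i, j)"
    using ij c by (simp only: mat_entry) (intro finsum_cong', auto simp: mat_entry intro!: finsum_closed)
  finally show "((M \<otimes>\<^bsub>mat_alg n A\<^esub> N) \<otimes>\<^bsub>mat_alg n A\<^esub> P) (i, j)
    = (M \<otimes>\<^bsub>mat_alg n A\<^esub> (N \<otimes>\<^bsub>mat_alg n A\<^esub> P)) (i, j)" .
qed (simp_all add: mat_extensional)

lemma finsum_delta:
  assumes "finite S" "i \<in> S" "f \<in> S \<rightarrow> carrier A"
  shows "(\<Oplus>k\<in>S. (if i = k then \<one> else \<zero>) \<otimes> f k) = f i"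
    and "(\<Oplus>k\<in>S. f k \<otimes> (if k = i then \<one> else \<zero>)) = f i"
proof -
  have "(\<Oplus>k\<in>S. (if i = k then \<one> else \<zero>) \<otimes> f k) = (\<Oplus>k\<in>S. if i = k then f k else \<zero>)"
    using assms by (intro finsum_cong') (auto simp: Pi_iff l_one r_one l_null r_null)
  also have "\<dots> = f i" using assms by (intro finsum_singleton) auto
  finally show "(\<Oplus>k\<in>S. (if i = k then \<one> else \<zero>) \<otimes> f k) = f i" .
  have "(\<Oplus>k\<in>S. f k \<otimes> (if k = i then \<one> else \<zero>)) = (\<Oplus>k\<in>S. if i = k then f k else \<zero>)"
    using assms by (intro finsum_cong') (auto simp: Pi_iff l_one r_one l_null r_null)
  also have "\<dots> = f i" using assms by (intro finsum_singleton) auto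
  finally show "(\<Oplus>k\<in>S. f k \<otimes> (if k = i then \<one> else \<zero>)) = f i" .
qed

lemma mat_closed:
  "\<lbrakk>M \<in> carrier (mat_alg n A); N \<in> carrier (mat_alg n A)\<rbrakk> \<Longrightarrow> M \<otimes>\<^bsub>mat_alg n A\<^esub> N \<in> carrier (mat_alg n A)"
  unfolding mat_carrier_iff by (auto simp only: mat_extensional mat_entry intro!: finsum_closed m_closed)

lemma star_algebra_mat_alg: "star_algebra (mat_alg n A)"
proof (rule star_algebraI)
  fix M N P assume M: "M \<in> carrier (mat_alg n A)" and N: "N \<in> carrier (mat_alg n A)"
    and P: "P \<in> carrier (mat_alg n A)"
  note c = mat_entry_closed[OF M] mat_entry_closed[OF N] mat_entry_closed[OF P]
  show "(M \<oplus>\<^bsub>mat_alg n A\<^esub> N) \<otimes>\<^bsub>mat_alg n A\<^esub> P = M \<otimes>\<^bsub>mat_alg n A\<^esub> P \<oplus>\<^bsub>mat_alg n A\<^esub> N \<otimes>\<^bsub>mat_alg n A\<^esub> P"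
  proof (rule mat_eqI[where n = n])
    fix i j assume ij: "i \<in> {1..n}" "j \<in> {1..n}"
    have eq: "(\<Oplus>k\<in>{1..n}. (M \<oplus>\<^bsub>mat_alg n A\<^esub> N) (i, k) \<otimes> P (k, j))
        = (\<Oplus>k\<in>{1..n}. M (i, k) \<otimes> P (k, j) \<oplus> N (i, k) \<otimes> P (k, j))"
      using ij c by (intro finsum_cong') (auto simp: mat_entry l_distr)
    show "((M \<oplus>\<^bsub>mat_alg n A\<^esub> N) \<otimes>\<^bsub>mat_alg n A\<^esub> P) (i, j) = (M \<otimes>\<^bsub>mat_alg n A\<^esub> P \<oplus>\<^bsub>mat_alg n A\<^esub> N \<otimes>\<^bsub>mat_alg n A\<^esub> P) (i, j)"
      unfolding mat_entry(1,4)[OF ij] using ij c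
      by (subst eq) (auto intro!: finsum_addf)
  qed (simp_all add: mat_extensional)
  show "P \<otimes>\<^bsub>mat_alg n A\<^esub> (M \<oplus>\<^bsub>mat_alg n A\<^esub> N) = P \<otimes>\<^bsub>mat_alg n A\<^esub> M \<oplus>\<^bsub>mat_alg n A\<^esub> P \<otimes>\<^bsub>mat_alg n A\<^esub> N"
  proof (rule mat_eqI[where n = n])
    fix i j assume ij: "i \<in> {1..n}" "j \<in> {1..n}"
    have eq: "(\<Oplus>k\<in>{1..n}. P (i, k) \<otimes> (M \<oplus>\<^bsub>mat_alg n A\<^esub> N) (k, j))
        = (\<Oplus>k\<in>{1..n}. P (i, k) \<otimes> M (k, j) \<oplus> P (i, k) \<otimes> N (k, j))"
      using ij c by (intro finsum_cong') (auto simp: mat_entry r_distr)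
    show "(P \<otimes>\<^bsub>mat_alg n A\<^esub> (M \<oplus>\<^bsub>mat_alg n A\<^esub> N)) (i, j) = (P \<otimes>\<^bsub>mat_alg n A\<^esub> M \<oplus>\<^bsub>mat_alg n A\<^esub> P \<otimes>\<^bsub>mat_alg n A\<^esub> N) (i, j)"
      unfolding mat_entry(1,4)[OF ij] using ij c
      by (subst eq) (auto intro!: finsum_addf)
  qed (simp_all add: mat_extensional)
next
  fix M N c assume M: "M \<in> carrier (mat_alg n A)" and N: "N \<in> carrier (mat_alg n A)"
  note c = mat_entry_closed[OF M] mat_entry_closed[OF N]
  show "(c \<odot>\<^bsub>mat_alg n A\<^esub> M) \<otimes>\<^bsub>mat_alg n A\<^esub> N = c \<odot>\<^bsub>mat_alg n A\<^esub> (M \<otimes>\<^bsub>mat_alg n A\<^esub> N)"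
    by (rule mat_eqI[where n = n])
      (auto simp: mat_extensional mat_entry c smult_finsum smult_mult_left scaling intro!: finsum_cong')
  show "M \<otimes>\<^bsub>mat_alg n A\<^esub> (c \<odot>\<^bsub>mat_alg n A\<^esub> N) = c \<odot>\<^bsub>mat_alg n A\<^esub> (M \<otimes>\<^bsub>mat_alg n A\<^esub> N)"
    by (rule mat_eqI[where n = n])
      (auto simp: mat_extensional mat_entry c smult_finsum smult_mult_right scaling intro!: finsum_cong')
  show "adj (mat_alg n A) (M \<otimes>\<^bsub>mat_alg n A\<^esub> N) = adj (mat_alg n A) N \<otimes>\<^bsub>mat_alg n A\<^esub> adj (mat_alg n A) M"
    by (rule mat_eqI[where n = n])
      (auto simp: mat_extensional mat_entry c adj_finsum adj_mult adj_closed intro!: finsum_cong')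
next
  fix M assume M: "M \<in> carrier (mat_alg n A)"
  note c = mat_entry_closed[OF M]
  show "\<one>\<^bsub>mat_alg n A\<^esub> \<otimes>\<^bsub>mat_alg n A\<^esub> M = M"
  proof (rule mat_eqI[where n = n])
    fix i j assume ij: "i \<in> {1..n}" "j \<in> {1..n}"
    have "(\<one>\<^bsub>mat_alg n A\<^esub> \<otimes>\<^bsub>mat_alg n A\<^esub> M) (i, j) = (\<Oplus>k\<in>{1..n}. (if i = k then \<one> else \<zero>) \<otimes> M (k, j))"
      using ij c by (simp only: mat_entry) (auto simp: mat_entry intro!: finsum_cong')
    also have "\<dots> = M (i, j)" using ij c by (intro finsum_delta) auto
    finally show "(\<one>\<^bsub>mat_alg n A\<^esub> \<otimes>\<^bsub>mat_alg n A\<^esub> M) (i, j) = M (i, j)" .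
  qed (simp_all add: mat_extensional(1) mat_extensional(7)[OF M])
  show "M \<otimes>\<^bsub>mat_alg n A\<^esub> \<one>\<^bsub>mat_alg n A\<^esub> = M"
  proof (rule mat_eqI[where n = n])
    fix i j assume ij: "i \<in> {1..n}" "j \<in> {1..n}"
    have "(M \<otimes>\<^bsub>mat_alg n A\<^esub> \<one>\<^bsub>mat_alg n A\<^esub>) (i, j) = (\<Oplus>k\<in>{1..n}. M (i, k) \<otimes> (if k = j then \<one> else \<zero>))"
      using ij c by (simp only: mat_entry) (auto simp: mat_entry intro!: finsum_cong')
    also have "\<dots> = M (i, j)" using ij c by (intro finsum_delta) auto
    finally show "(M \<otimes>\<^bsub>mat_alg n A\<^esub> \<one>\<^bsub>mat_alg n A\<^esub>) (i, j) = M (i, j)" .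
  qed (simp_all add: mat_extensional(1) mat_extensional(7)[OF M])
next
  fix x y z assume "x \<in> carrier (mat_alg n A)" "y \<in> carrier (mat_alg n A)" "z \<in> carrier (mat_alg n A)"
  then show "x \<otimes>\<^bsub>mat_alg n A\<^esub> y \<otimes>\<^bsub>mat_alg n A\<^esub> z = x \<otimes>\<^bsub>mat_alg n A\<^esub> (y \<otimes>\<^bsub>mat_alg n A\<^esub> z)"
    by (rule mat_mult_assoc)
next
  fix M N P assume "M \<in> carrier (mat_alg n A)" "N \<in> carrier (mat_alg n A)" "P \<in> carrier (mat_alg n A)"
  note c = mat_entry_closed[OF this(1)] mat_entry_closed[OF this(2)] mat_entry_closed[OF this(3)]
  show "(M \<oplus>\<^bsub>mat_alg n A\<^esub> N) \<oplus>\<^bsub>mat_alg n A\<^esub> P = M \<oplus>\<^bsub>mat_alg n A\<^esub> (N \<oplus>\<^bsub>mat_alg n A\<^esub> P)"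
    by (rule mat_eqI[where n = n]) (simp_all add: mat_extensional(4) mat_entry(4) c a_assoc)
next
  fix M N assume "M \<in> carrier (mat_alg n A)" "N \<in> carrier (mat_alg n A)"
  note c = mat_entry_closed[OF this(1)] mat_entry_closed[OF this(2)]
  show "M \<oplus>\<^bsub>mat_alg n A\<^esub> N = N \<oplus>\<^bsub>mat_alg n A\<^esub> M"
    by (rule mat_eqI[where n = n]) (simp_all add: mat_extensional(4) mat_entry(4) c a_comm)
  show "adj (mat_alg n A) (M \<oplus>\<^bsub>mat_alg n A\<^esub> N) = adj (mat_alg n A) M \<oplus>\<^bsub>mat_alg n A\<^esub> adj (mat_alg n A) N"
    by (rule mat_eqI[where n = n]) (simp_all add: mat_extensional(4,6) mat_entry(4,6) c adj_add)
  show "k \<odot>\<^bsub>mat_alg n A\<^esub> (M \<oplus>\<^bsub>mat_alg n A\<^esub> N) = k \<odot>\<^bsub>mat_alg n A\<^esub> M \<oplus>\<^bsub>mat_alg n A\<^esub> k \<odot>\<^bsub>mat_alg n A\<^esub> N" for k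
    by (rule mat_eqI[where n = n]) (simp_all add: mat_extensional(4,5) mat_entry(4,5) c scaling)
next
  fix M assume M: "M \<in> carrier (mat_alg n A)"
  note c = mat_entry_closed[OF M] and e = mat_extensional(1-6) mat_extensional(7)[OF M]
  show "\<zero>\<^bsub>mat_alg n A\<^esub> \<oplus>\<^bsub>mat_alg n A\<^esub> M = M" "((-1) \<odot>\<^bsub>mat_alg n A\<^esub> M) \<oplus>\<^bsub>mat_alg n A\<^esub> M = \<zero>\<^bsub>mat_alg n A\<^esub>"
    "1 \<odot>\<^bsub>mat_alg n A\<^esub> M = M" "adj (mat_alg n A) (adj (mat_alg n A) M) = M"
    by (rule mat_eqI[where n = n]; simp add: e mat_entry c scaling smult_minus_one adj_adj)+
  show "(k + l) \<odot>\<^bsub>mat_alg n A\<^esub> M = k \<odot>\<^bsub>mat_alg n A\<^esub> M \<oplus>\<^bsub>mat_alg n A\<^esub> l \<odot>\<^bsub>mat_alg n A\<^esub> M"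
    "(k * l) \<odot>\<^bsub>mat_alg n A\<^esub> M = k \<odot>\<^bsub>mat_alg n A\<^esub> (l \<odot>\<^bsub>mat_alg n A\<^esub> M)"
    "adj (mat_alg n A) (k \<odot>\<^bsub>mat_alg n A\<^esub> M) = cnj k \<odot>\<^bsub>mat_alg n A\<^esub> adj (mat_alg n A) M" for k l
    by (rule mat_eqI[where n = n]; simp add: e mat_entry c scaling adj_smult)+
qed (simp_all add: mat_closed, simp_all add: mat_carrier_iff mat_extensional mat_entry scaling adj_closed)

end

section \<open>Generated subalgebras\<close>

lemma star_subalgebraD:
  assumes "star_subalgebra S A"
  shows "x \<in> S \<Longrightarrow> x \<in> carrier A" "\<zero>\<^bsub>A\<^esub> \<in> S" "\<lbrakk>x \<in> S; y \<in> S\<rbrakk> \<Longrightarrow> x \<oplus>\<^bsub>A\<^esub> y \<in> S"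
    "\<lbrakk>x \<in> S; y \<in> S\<rbrakk> \<Longrightarrow> x \<otimes>\<^bsub>A\<^esub> y \<in> S" "x \<in> S \<Longrightarrow> adj A x \<in> S" "x \<in> S \<Longrightarrow> c \<odot>\<^bsub>A\<^esub> x \<in> S"
  using assms unfolding star_subalgebra_def by blast+

lemma generated_incl: "S \<subseteq> generated_star_algebra A S"
  unfolding generated_star_algebra_def by (rule hull_subset)

lemma generated_minimal:
  "\<lbrakk>S \<subseteq> T; star_subalgebra T A; \<one>\<^bsub>A\<^esub> \<in> T\<rbrakk> \<Longrightarrow> generated_star_algebra A S \<subseteq> T"
  unfolding generated_star_algebra_def by (rule hull_minimal) simp_all

context star_algebra
begin

lemma star_subalgebra_carrier: "star_subalgebra (carrier A) A"
  by (simp add: star_subalgebra_def algebra_closed)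

lemma generated_subset_carrier: "S \<subseteq> carrier A \<Longrightarrow> generated_star_algebra A S \<subseteq> carrier A"
  by (intro generated_minimal star_subalgebra_carrier one_closed)

lemma generated_iff:
  "x \<in> generated_star_algebra A S \<longleftrightarrow>
     (\<forall>T. S \<subseteq> T \<longrightarrow> star_subalgebra T A \<longrightarrow> \<one> \<in> T \<longrightarrow> x \<in> T)"
  unfolding generated_star_algebra_def hull_def by blast

lemma one_in_generated: "\<one> \<in> generated_star_algebra A S"
  by (simp add: generated_iff)

lemma generated_star_subalgebra:
  assumes "S \<subseteq> carrier A"
  shows "star_subalgebra (generated_star_algebra A S) A"
  unfolding star_subalgebra_def
proof (intro conjI ballI allI)
  show "generated_star_algebra A S \<subseteq> carrier A"
    by (rule generated_subset_carrier[OF assms])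
  show "\<zero> \<in> generated_star_algebra A S"
    by (simp add: generated_iff star_subalgebraD(2))
  fix x assume x: "x \<in> generated_star_algebra A S"
  then show "adj A x \<in> generated_star_algebra A S"
    by (simp add: generated_iff star_subalgebraD(5))
  show "c \<odot> x \<in> generated_star_algebra A S" for c
    using x by (simp add: generated_iff star_subalgebraD(6))
  fix y assume y: "y \<in> generated_star_algebra A S"
  show "x \<oplus> y \<in> generated_star_algebra A S"
    using x y by (simp add: generated_iff star_subalgebraD(3))
  show "x \<otimes> y \<in> generated_star_algebra A S"
    using x y by (simp add: generated_iff star_subalgebraD(4))
qed

lemma finsum_in_subalgebra:
  assumes "star_subalgebra T A" "f \<in> S \<rightarrow> T"
  shows "finsum A f S \<in> T"
  using assms(2)
proof (induction S rule: infinite_finite_induct)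
  case (insert i S)
  then have "f \<in> S \<rightarrow> carrier A" "f i \<in> carrier A"
    using star_subalgebraD(1)[OF assms(1)] by auto
  with insert show ?case
    using star_subalgebraD(3)[OF assms(1)] by auto
qed (simp_all add: star_subalgebraD(2)[OF assms(1)])

lemma mat_over_subset_iff:
  "M \<in> carrier (mat_alg n (A\<lparr>carrier := T\<rparr>)) \<longleftrightarrow>
     M \<in> extensional (mat_indices n) \<and> (\<forall>i\<in>{1..n}. \<forall>j\<in>{1..n}. M (i, j) \<in> T)"
  by (simp add: mat_carrier_iff)

lemma mat_star_subalgebra:
  assumes "star_subalgebra T A"
  shows "star_subalgebra (carrier (mat_alg n (A\<lparr>carrier := T\<rparr>))) (mat_alg n A)"
  unfolding star_subalgebra_def mat_over_subset_iff
proof (intro conjI ballI allI subsetI)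
  note T = star_subalgebraD[OF assms]
  fix M assume M: "M \<in> carrier (mat_alg n (A\<lparr>carrier := T\<rparr>))"
  then have MT: "M (i, j) \<in> T" if "i \<in> {1..n}" "j \<in> {1..n}" for i j
    using that unfolding mat_over_subset_iff by blast
  have Me: "M \<in> extensional (mat_indices n)"
    using M unfolding mat_over_subset_iff by blast
  show "M \<in> carrier (mat_alg n A)"
    using Me MT T(1) unfolding mat_carrier_iff by blast
  fix i j assume ij: "i \<in> {1..n}" "j \<in> {1..n}"
  show "adj (mat_alg n A) M (i, j) \<in> T"
    unfolding mat_entry[OF ij] by (intro T MT ij)
  show "(c \<odot>\<^bsub>mat_alg n A\<^esub> M) (i, j) \<in> T" for c
    unfolding mat_entry[OF ij] by (intro T MT ij)
  fix N assume N: "N \<in> carrier (mat_alg n (A\<lparr>carrier := T\<rparr>))"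
  then have NT: "N (i, j) \<in> T" if "i \<in> {1..n}" "j \<in> {1..n}" for i j
    using that unfolding mat_over_subset_iff by blast
  show "(M \<oplus>\<^bsub>mat_alg n A\<^esub> N) (i, j) \<in> T"
    unfolding mat_entry[OF ij] by (intro T MT NT ij)
  show "(M \<otimes>\<^bsub>mat_alg n A\<^esub> N) (i, j) \<in> T"
    unfolding mat_entry[OF ij]
    by (intro finsum_in_subalgebra[OF assms] funcsetI T MT NT ij)
next
  fix i j assume "i \<in> {1..n}" "j \<in> {1..n}"
  then show "\<zero>\<^bsub>mat_alg n A\<^esub> (i, j) \<in> T"
    using star_subalgebraD(2)[OF assms] by (simp add: mat_entry)
qed (rule mat_extensional)+

end

section \<open>Corners\<close>

lemma corner_simps [simp]:
  "mult (corner A e) = mult A" "one (corner A e) = e" "zero (corner A e) = zero A"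
  "add (corner A e) = add A" "smult (corner A e) = smult A" "adj (corner A e) = adj A"
  "carrier (corner A e) = {e \<otimes>\<^bsub>A\<^esub> x \<otimes>\<^bsub>A\<^esub> e | x. x \<in> carrier A}"
  by (simp_all add: corner_def)

context star_algebra
begin

lemma corner_carrier_iff:
  assumes "e \<in> carrier A" "e \<otimes> e = e"
  shows "x \<in> carrier (corner A e) \<longleftrightarrow> x \<in> carrier A \<and> e \<otimes> x = x \<and> x \<otimes> e = x"
proof
  assume "x \<in> carrier (corner A e)"
  then obtain y where y: "y \<in> carrier A" "x = e \<otimes> y \<otimes> e" by auto
  have "e \<otimes> x = (e \<otimes> e) \<otimes> y \<otimes> e" "x \<otimes> e = e \<otimes> y \<otimes> (e \<otimes> e)"
    unfolding y(2) using assms(1) y(1) by (simp_all add: m_assoc)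
  then show "x \<in> carrier A \<and> e \<otimes> x = x \<and> x \<otimes> e = x"
    using assms y by simp
next
  assume "x \<in> carrier A \<and> e \<otimes> x = x \<and> x \<otimes> e = x"
  then show "x \<in> carrier (corner A e)"
    by (auto intro!: exI[of _ x])
qed

text \<open>Self-adjointness of the idempotent \<open>e\<close> is what makes \<open>eAe\<close> closed under the
  involution.\<close>
lemma star_algebra_corner:
  assumes e: "e \<in> carrier A" "e \<otimes> e = e" "adj A e = e"
  shows "star_algebra (corner A e)"
proof -
  note iff = corner_carrier_iff[OF e(1,2)]
  show ?thesis
  proof (rule star_algebraI)
    fix x y assume "x \<in> carrier (corner A e)" "y \<in> carrier (corner A e)"
    then show "x \<oplus>\<^bsub>corner A e\<^esub> y = y \<oplus>\<^bsub>corner A e\<^esub> x"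
      unfolding iff by (simp add: a_comm)
  next
    fix x y assume "x \<in> carrier (corner A e)" "y \<in> carrier (corner A e)"
    then have xy: "x \<in> carrier A" "e \<otimes> x = x" "x \<otimes> e = x" "y \<in> carrier A" "e \<otimes> y = y" "y \<otimes> e = y"
      by (simp_all only: iff)
    show "x \<otimes>\<^bsub>corner A e\<^esub> y \<in> carrier (corner A e)"
      unfolding iff using xy e(1) m_assoc[of e x y] m_assoc[of x y e] by simp
    show "x \<oplus>\<^bsub>corner A e\<^esub> y \<in> carrier (corner A e)"
      unfolding iff using xy e(1) by (simp add: l_distr r_distr)
    show "adj (corner A e) x \<in> carrier (corner A e)"
      unfolding iff using xy e adj_mult[of x e] adj_mult[of e x] by (simp add: adj_closed)
    show "c \<odot>\<^bsub>corner A e\<^esub> x \<in> carrier (corner A e)" for c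
      unfolding iff using xy e(1) by (simp add: scaling smult_mult_left smult_mult_right)
  qed (use e in \<open>simp_all only: iff corner_simps(1-6), simp_all add: a_assoc m_assoc l_distr r_distr
         scaling smult_minus_one adj_closed adj_adj adj_add adj_mult adj_smult
         smult_mult_left smult_mult_right\<close>)
qed

text \<open>Not immediate from \<open>corner_simps\<close>, because the definition of a finite sum in a monoid
  refers to the carrier, which the corner changes.\<close>
lemma finsum_corner:
  assumes e: "e \<in> carrier A" "e \<otimes> e = e" "adj A e = e"
    and f: "f \<in> S \<rightarrow> carrier (corner A e)"
  shows "finsum (corner A e) f S = finsum A f S"
proof -
  interpret K: star_algebra "corner A e" by (rule star_algebra_corner[OF e])
  note iff = corner_carrier_iff[OF e(1,2)]
  show ?thesis
    using f
  proof (induction S rule: infinite_finite_induct)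
    case (infinite S)
    then show ?case by (simp add: finsum_def finprod_def)
  next
    case empty
    show ?case using K.finsum_empty by simp
  next
    case (insert i S)
    then have i: "f \<in> S \<rightarrow> carrier (corner A e)" "f i \<in> carrier (corner A e)" by auto
    then have j: "f \<in> S \<rightarrow> carrier A" "f i \<in> carrier A" unfolding Pi_iff iff by auto
    have "finsum (corner A e) f (insert i S) = f i \<oplus>\<^bsub>corner A e\<^esub> finsum (corner A e) f S"
      using K.finsum_insert[OF insert(1,2) i] .
    also have "\<dots> = f i \<oplus> finsum A f S"
      using insert.IH[OF i(1)] by simp
    also have "\<dots> = finsum A f (insert i S)"
      using insert(1,2) j by simp
    finally show ?case .
  qed
qed

end

section \<open>Alternating words\<close>

definition alternating_words ::
    "('a, 'm) star_algebra_scheme \<Rightarrow> ('a \<Rightarrow> complex) \<Rightarrow> 'a set \<Rightarrow> 'a set \<Rightarrow> (bool \<times> 'a) list set" where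
  "alternating_words A \<phi> S T = {ws. ws \<noteq> [] \<and> distinct_adj (map fst ws) \<and>
     (\<forall>(b, x)\<in>set ws. x \<in> generated_star_algebra A (if b then T else S) \<and> \<phi> x = 0)}"

lemma star_free_iff_words:
  "star_free A \<phi> S T \<longleftrightarrow> (\<forall>ws\<in>alternating_words A \<phi> S T. \<phi> (alg_prod A (map snd ws)) = 0)"
  unfolding star_free_def alternating_words_def by blast

text \<open>Sums of alternating words whose first letter is of kind \<open>b\<close>. Fixing the kind of the first
  letter tells which letters can be multiplied on the left without destroying alternation.
  Closure under sums accommodates the sums in matrix products; scalar multiples can be absorbed
  in a letter and are not generated separately.\<close>
inductive_set alternating_span ::
    "('a, 'm) star_algebra_scheme \<Rightarrow> ('a \<Rightarrow> complex) \<Rightarrow> 'a set \<Rightarrow> 'a set \<Rightarrow> bool \<Rightarrow> 'a set"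
  for A \<phi> S T b where
  word: "\<lbrakk>ws \<in> alternating_words A \<phi> S T; fst (hd ws) = b\<rbrakk> \<Longrightarrow>
    alg_prod A (map snd ws) \<in> alternating_span A \<phi> S T b"
| add: "\<lbrakk>x \<in> alternating_span A \<phi> S T b; y \<in> alternating_span A \<phi> S T b\<rbrakk> \<Longrightarrow>
    x \<oplus>\<^bsub>A\<^esub> y \<in> alternating_span A \<phi> S T b"

context star_prob_space
begin

lemma state_zero: "\<phi> \<zero> = 0"
  using state_smult[of \<zero> 0] by (simp add: scaling)

lemma state_finsum: "f \<in> S \<rightarrow> carrier A \<Longrightarrow> \<phi> (finsum A f S) = (\<Sum>i\<in>S. \<phi> (f i))"
proof (induction S rule: infinite_finite_induct)
  case (insert i S)
  then have "f i \<in> carrier A" "f \<in> S \<rightarrow> carrier A" by auto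
  with insert show ?case
    by (simp add: state_add)
qed (simp_all add: state_zero)

lemma alternating_words_carrier:
  assumes "S \<subseteq> carrier A" "T \<subseteq> carrier A" "ws \<in> alternating_words A \<phi> S T"
  shows "set (map snd ws) \<subseteq> carrier A"
  using assms(3) generated_subset_carrier[OF assms(1)] generated_subset_carrier[OF assms(2)]
  by (fastforce simp: alternating_words_def split: if_splits)

lemma alternating_span_carrier:
  assumes "S \<subseteq> carrier A" "T \<subseteq> carrier A" "x \<in> alternating_span A \<phi> S T b"
  shows "x \<in> carrier A"
  using assms(3)
  by induction (auto intro!: alg_prod_closed alternating_words_carrier[OF assms(1,2)])

lemma alternating_span_letter:
  assumes "S \<subseteq> carrier A" "T \<subseteq> carrier A"
    and "x \<in> generated_star_algebra A (if b then T else S)" "\<phi> x = 0"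
  shows "x \<in> alternating_span A \<phi> S T b"
proof -
  have "[(b, x)] \<in> alternating_words A \<phi> S T"
    using assms by (simp add: alternating_words_def)
  then have "alg_prod A (map snd [(b, x)]) \<in> alternating_span A \<phi> S T b"
    by (rule alternating_span.word) simp
  moreover have "x \<in> carrier A"
    using assms generated_subset_carrier by (cases b) auto
  ultimately show ?thesis by simp
qed

lemma alternating_span_mult:
  assumes ST: "S \<subseteq> carrier A" "T \<subseteq> carrier A"
    and x: "x \<in> generated_star_algebra A (if b then T else S)" "\<phi> x = 0"
    and y: "y \<in> alternating_span A \<phi> S T (\<not> b)"
  shows "x \<otimes> y \<in> alternating_span A \<phi> S T b"
proof -
  have xc: "x \<in> carrier A"
    using ST x(1) generated_subset_carrier by (cases b) auto
  show ?thesis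
    using y
  proof induction
    case (word ws)
    then have "(b, x) # ws \<in> alternating_words A \<phi> S T"
      using x by (auto simp: alternating_words_def distinct_adj_Cons hd_map)
    then have "alg_prod A (map snd ((b, x) # ws)) \<in> alternating_span A \<phi> S T b"
      by (rule alternating_span.word) simp
    then show ?case by simp
  next
    case (add y z)
    then show ?case
      using xc alternating_span_carrier[OF ST] by (simp add: r_distr alternating_span.add)
  qed
qed

lemma alternating_span_finsum:
  assumes ST: "S \<subseteq> carrier A" "T \<subseteq> carrier A"
    and f: "\<And>i. i \<in> I \<Longrightarrow> f i \<in> alternating_span A \<phi> S T b"
  shows "finsum A f I \<in> alternating_span A \<phi> S T b"
proof -
  have zero: "\<zero> \<in> alternating_span A \<phi> S T b"
    using ST star_subalgebraD(2)[OF generated_star_subalgebra]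
    by (intro alternating_span_letter) (auto simp: state_zero)
  show ?thesis
    using f
  proof (induction I rule: infinite_finite_induct)
    case (insert i I)
    have "f i \<in> carrier A" "f \<in> I \<rightarrow> carrier A"
      using insert.prems alternating_span_carrier[OF ST] by auto
    with insert show ?case
      by (simp add: alternating_span.add)
  qed (simp_all add: zero)
qed

lemma alternating_span_state:
  assumes ST: "S \<subseteq> carrier A" "T \<subseteq> carrier A" and "star_free A \<phi> S T"
    and "x \<in> alternating_span A \<phi> S T b"
  shows "\<phi> x = 0"
  using assms(4)
proof induction
  case (word ws)
  then show ?case using assms(3) by (simp add: star_free_iff_words)
next
  case (add x y)
  then show ?case using alternating_span_carrier[OF ST] by (simp add: state_add)
qed

text \<open>The decomposition \<open>x = (x - \<phi>(x)1) + \<phi>(x)1\<close>.\<close>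
lemma centring:
  assumes "star_subalgebra T A" "\<one> \<in> T" "x \<in> T"
  obtains x' where "x' \<in> T" "\<phi> x' = 0" "x = x' \<oplus> (\<phi> x \<odot> \<one>)"
proof
  note T = star_subalgebraD[OF assms(1)]
  have x: "x \<in> carrier A" using T(1) assms(3) .
  show "x \<oplus> (- \<phi> x) \<odot> \<one> \<in> T" by (intro T(3,6) assms)
  show "\<phi> (x \<oplus> (- \<phi> x) \<odot> \<one>) = 0"
    using x by (simp add: state_add state_smult state_one scaling one_closed)
  show "x = x \<oplus> (- \<phi> x) \<odot> \<one> \<oplus> (\<phi> x \<odot> \<one>)"
    using x scaling(2)[of \<one> "- \<phi> x" "\<phi> x"]
    by (simp add: a_assoc scaling one_closed)
qed

text \<open>The outer factors \<open>a\<close> and \<open>b\<close> need not be centred. With \<open>a = a' + \<phi>(a)\<close> and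
  \<open>b = b' + \<phi>(b)\<close>, each of the four terms of the expansion is a multiple of an alternating
  centred word: the word begins and ends in the algebra of \<open>T\<close>, so it remains alternating
  with or without \<open>a'\<close> on its left and \<open>b'\<close> on its right.\<close>
lemma state_sandwich_word:
  assumes ST: "S \<subseteq> carrier A" "T \<subseteq> carrier A" and free: "star_free A \<phi> S T"
    and ws: "ws \<in> alternating_words A \<phi> S T" "fst (hd ws)" "fst (last ws)"
    and a: "a \<in> generated_star_algebra A S" and b: "b \<in> generated_star_algebra A S"
  shows "\<phi> (a \<otimes> alg_prod A (map snd ws) \<otimes> b) = 0"
proof -
  let ?P = "alg_prod A (map snd ws)"
  have wsne: "ws \<noteq> []" using ws(1) by (simp add: alternating_words_def)
  note gen = generated_star_subalgebra[OF ST(1)] one_in_generated[of S]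
  obtain a' where a': "a' \<in> generated_star_algebra A S" "\<phi> a' = 0" "a = a' \<oplus> (\<phi> a \<odot> \<one>)"
    using centring[OF gen a] .
  obtain b' where b': "b' \<in> generated_star_algebra A S" "\<phi> b' = 0" "b = b' \<oplus> (\<phi> b \<odot> \<one>)"
    using centring[OF gen b] .
  have P: "?P \<in> carrier A"
    by (rule alg_prod_closed[OF alternating_words_carrier[OF ST ws(1)]])
  have ac: "a' \<in> carrier A" and bc: "b' \<in> carrier A"
    using a' b' star_subalgebraD(1)[OF gen(1)] by auto
  have app: "alg_prod A (map snd (ws @ [(False, b')])) = ?P \<otimes> b'"
    using alg_prod_append[OF alternating_words_carrier[OF ST ws(1)], of "[b']"] bc by simp
  have "ws @ [(False, b')] \<in> alternating_words A \<phi> S T"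
    using ws b' wsne by (auto simp: alternating_words_def distinct_adj_append_iff last_map)
  moreover have "(False, a') # ws \<in> alternating_words A \<phi> S T"
    using ws a' by (auto simp: alternating_words_def distinct_adj_Cons hd_map)
  moreover have "(False, a') # ws @ [(False, b')] \<in> alternating_words A \<phi> S T"
    using ws a' b' wsne
    by (auto simp: alternating_words_def distinct_adj_append_iff last_map distinct_adj_Cons hd_map)
  ultimately have zero: "\<phi> (?P \<otimes> b') = 0" "\<phi> (a' \<otimes> ?P) = 0" "\<phi> (a' \<otimes> (?P \<otimes> b')) = 0" "\<phi> ?P = 0"
    using free ws(1) unfolding star_free_iff_words
    by (metis app, metis alg_prod_simps(2) list.simps(9) snd_conv,
        metis app alg_prod_simps(2) list.simps(9) snd_conv, blast)
  have "a \<otimes> ?P \<otimes> b = (a' \<oplus> (\<phi> a \<odot> \<one>)) \<otimes> ?P \<otimes> (b' \<oplus> (\<phi> b \<odot> \<one>))"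
    using a'(3) b'(3) by simp
  also have "\<dots> = (a' \<otimes> (?P \<otimes> b') \<oplus> (\<phi> a \<odot> (?P \<otimes> b')))
      \<oplus> (\<phi> b \<odot> (a' \<otimes> ?P \<oplus> (\<phi> a \<odot> ?P)))"
    using ac bc P
    by (simp add: l_distr r_distr smult_mult_left smult_mult_right scaling one_closed m_assoc)
  finally show ?thesis
    using ac bc P zero by (simp add: state_add state_smult scaling)
qed

text \<open>Subtracting from \<open>y\<close> its expectation reduces to the previous lemma with a word of one
  letter.\<close>
lemma state_sandwich:
  assumes ST: "S \<subseteq> carrier A" "T \<subseteq> carrier A" and free: "star_free A \<phi> S T"
    and y: "y \<in> generated_star_algebra A T"
    and a: "a \<in> generated_star_algebra A S" and b: "b \<in> generated_star_algebra A S"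
  shows "\<phi> (a \<otimes> y \<otimes> b) = \<phi> y * \<phi> (a \<otimes> b)"
proof -
  obtain y' where y': "y' \<in> generated_star_algebra A T" "\<phi> y' = 0" "y = y' \<oplus> (\<phi> y \<odot> \<one>)"
    using centring[OF generated_star_subalgebra[OF ST(2)] one_in_generated y] .
  have c: "a \<in> carrier A" "b \<in> carrier A" "y' \<in> carrier A"
    using a b y'(1) generated_subset_carrier ST by blast+
  have "[(True, y')] \<in> alternating_words A \<phi> S T"
    using y' by (simp add: alternating_words_def)
  from state_sandwich_word[OF ST free this _ _ a b] have "\<phi> (a \<otimes> y' \<otimes> b) = 0"
    using c by simp
  moreover have "a \<otimes> y \<otimes> b = a \<otimes> y' \<otimes> b \<oplus> (\<phi> y \<odot> (a \<otimes> b))"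
    by (subst y'(3)) (use c in \<open>simp add: l_distr r_distr smult_mult_left smult_mult_right scaling one_closed\<close>)
  ultimately show ?thesis
    using c by (simp add: state_add state_smult scaling)
qed

end

section \<open>Families with equal distribution\<close>

definition star_monomial ::
    "('a, 'm) star_algebra_scheme \<Rightarrow> ('i \<Rightarrow> 'a) \<Rightarrow> ('i \<times> bool) list \<Rightarrow> 'a" where
  "star_monomial A x w = alg_prod A (map (\<lambda>(i, b). if b then adj A (x i) else x i) w)"

text \<open>Two elements correspond if they are values of one common \<open>*\<close>-polynomial at the two families.
  The polynomial is kept implicit, as a linear combination of monomials built up along with its
  two values: products and adjoints of polynomials then need no definition.\<close>
inductive corresponding ::
    "('a, 'm) star_algebra_scheme \<Rightarrow> ('i \<Rightarrow> 'a) \<Rightarrow> ('b, 'k) star_algebra_scheme \<Rightarrow> ('i \<Rightarrow> 'b) \<Rightarrow>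
      'i set \<Rightarrow> 'a \<Rightarrow> 'b \<Rightarrow> bool"
  for A x K y I where
  monomial: "w \<in> lists (I \<times> UNIV) \<Longrightarrow>
    corresponding A x K y I (star_monomial A x w) (star_monomial K y w)"
| smult: "corresponding A x K y I a c \<Longrightarrow> corresponding A x K y I (z \<odot>\<^bsub>A\<^esub> a) (z \<odot>\<^bsub>K\<^esub> c)"
| add: "\<lbrakk>corresponding A x K y I a c; corresponding A x K y I a' c'\<rbrakk> \<Longrightarrow>
    corresponding A x K y I (a \<oplus>\<^bsub>A\<^esub> a') (c \<oplus>\<^bsub>K\<^esub> c')"

context star_algebra
begin

lemma star_letter_closed:
  assumes "x \<in> I \<rightarrow> carrier A" "w \<in> lists (I \<times> UNIV)"
  shows "set (map (\<lambda>(i, b). if b then adj A (x i) else x i) w) \<subseteq> carrier A"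
  using assms by (auto simp: Pi_iff intro!: adj_closed)

lemma star_monomial_closed:
  "\<lbrakk>x \<in> I \<rightarrow> carrier A; w \<in> lists (I \<times> UNIV)\<rbrakk> \<Longrightarrow> star_monomial A x w \<in> carrier A"
  unfolding star_monomial_def by (intro alg_prod_closed star_letter_closed)

lemma star_monomial_append:
  "\<lbrakk>x \<in> I \<rightarrow> carrier A; w \<in> lists (I \<times> UNIV); w' \<in> lists (I \<times> UNIV)\<rbrakk> \<Longrightarrow>
     star_monomial A x (w @ w') = star_monomial A x w \<otimes> star_monomial A x w'"
  unfolding star_monomial_def map_append by (intro alg_prod_append star_letter_closed)

lemma adj_star_monomial:
  assumes "x \<in> I \<rightarrow> carrier A" "w \<in> lists (I \<times> UNIV)"
  shows "adj A (star_monomial A x w) = star_monomial A x (rev (map (\<lambda>(i, b). (i, \<not> b)) w))"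
proof -
  have "map (adj A) (map (\<lambda>(i, b). if b then adj A (x i) else x i) w)
      = map (\<lambda>(i, b). if b then adj A (x i) else x i) (map (\<lambda>(i, b). (i, \<not> b)) w)"
    using assms by (auto simp: adj_adj Pi_iff)
  then show ?thesis
    unfolding star_monomial_def adj_alg_prod[OF star_letter_closed[OF assms]]
    by (simp only: rev_map[symmetric])
qed

lemma eval_single:
  assumes "x \<in> I \<rightarrow> carrier A" "w \<in> lists (I \<times> UNIV)"
  shows "eval_star_polynomial A x (Poly_Mapping.single w 1) = star_monomial A x w"
  using star_monomial_closed[OF assms]
  by (simp add: eval_star_polynomial_def scaling star_monomial_def[symmetric])

end

locale two_families = A: star_algebra A + K: star_algebra K
  for A :: "('a, 'm) star_algebra_scheme" and K :: "('b, 'k) star_algebra_scheme" +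
  fixes I :: "'i set" and x :: "'i \<Rightarrow> 'a" and y :: "'i \<Rightarrow> 'b"
  assumes x: "x \<in> I \<rightarrow> carrier A" and y: "y \<in> I \<rightarrow> carrier K"
begin

abbreviation corr :: "'a \<Rightarrow> 'b \<Rightarrow> bool" where
  "corr \<equiv> corresponding A x K y I"

lemma corr_closed:
  assumes "corr a c" shows "a \<in> carrier A" "c \<in> carrier K"
  using assms by induction
    (auto simp: A.star_monomial_closed[OF x] K.star_monomial_closed[OF y] A.scaling K.scaling)

lemma corr_generator: "i \<in> I \<Longrightarrow> corr (x i) (y i)"
  using corresponding.monomial[of "[(i, False)]" I A x K y] x y
  by (auto simp: star_monomial_def Pi_iff)

lemma corr_scalar: "corr (c \<odot>\<^bsub>A\<^esub> \<one>\<^bsub>A\<^esub>) (c \<odot>\<^bsub>K\<^esub> \<one>\<^bsub>K\<^esub>)"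
  using corresponding.smult[OF corresponding.monomial[of "[]" I A x K y], of c]
  by (simp add: star_monomial_def)

lemma corr_zero: "corr \<zero>\<^bsub>A\<^esub> \<zero>\<^bsub>K\<^esub>"
  using corr_scalar[of 0] by (simp add: A.scaling K.scaling)

text \<open>By bilinearity, products reduce to products of monomials, and these to concatenation of
  words.\<close>
lemma corr_mult:
  assumes "corr a c" "corr a' c'"
  shows "corr (a \<otimes>\<^bsub>A\<^esub> a') (c \<otimes>\<^bsub>K\<^esub> c')"
  using assms(1)
proof induction
  case (monomial w)
  show ?case
    using assms(2)
  proof induction
    case (monomial w')
    then show ?case
      using corresponding.monomial[of "w @ w'" I A x K y] \<open>w \<in> lists (I \<times> UNIV)\<close>
      by (simp add: A.star_monomial_append[OF x] K.star_monomial_append[OF y])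
  next
    case (smult a c z)
    then show ?case
      using corr_closed[of a c] \<open>w \<in> lists (I \<times> UNIV)\<close> corresponding.smult[OF smult.IH, of z]
      by (simp add: A.smult_mult_right K.smult_mult_right A.star_monomial_closed[OF x]
          K.star_monomial_closed[OF y])
  next
    case (add a c a' c')
    then show ?case
      using corr_closed[of a c] corr_closed[of a' c'] \<open>w \<in> lists (I \<times> UNIV)\<close>
        corresponding.add[OF add.IH]
      by (simp add: A.r_distr K.r_distr A.star_monomial_closed[OF x]
          K.star_monomial_closed[OF y])
  qed
next
  case (smult a c z)
  then show ?case
    using corr_closed[of a c] corr_closed[OF assms(2)] corresponding.smult[OF smult.IH, of z]
    by (simp add: A.smult_mult_left K.smult_mult_left)
next
  case (add b d b' d')
  then show ?case
    using corr_closed[of b d] corr_closed[of b' d'] corr_closed[OF assms(2)]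
      corresponding.add[OF add.IH]
    by (simp add: A.l_distr K.l_distr)
qed

lemma corr_adj: "corr a c \<Longrightarrow> corr (adj A a) (adj K c)"
proof (induction rule: corresponding.induct)
  case (monomial w)
  have "rev (map (\<lambda>(i, b). (i, \<not> b)) w) \<in> lists (I \<times> UNIV)"
    using monomial by auto
  from corresponding.monomial[OF this, of A x K y] show ?case
    by (simp only: A.adj_star_monomial[OF x monomial] K.adj_star_monomial[OF y monomial])
next
  case (smult a c z)
  then show ?case
    using corr_closed[of a c] corresponding.smult[OF smult.IH, of "cnj z"]
    by (simp add: A.adj_smult K.adj_smult)
next
  case (add a c a' c')
  then show ?case
    using corr_closed[of a c] corr_closed[of a' c'] corresponding.add[OF add.IH]
    by (simp add: A.adj_add K.adj_add)
qed

lemma corr_finsum: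
  assumes "\<And>i. i \<in> S \<Longrightarrow> corr (f i) (g i)"
  shows "corr (finsum A f S) (finsum K g S)"
  using assms
proof (induction S rule: infinite_finite_induct)
  case (insert i S)
  have "f i \<in> carrier A" "f \<in> S \<rightarrow> carrier A" "g i \<in> carrier K" "g \<in> S \<rightarrow> carrier K"
    using insert.prems corr_closed by blast+
  with insert show ?case
    by (simp add: corresponding.add)
qed (simp_all add: corr_zero)

lemma corr_generated:
  assumes "corr a c" shows "a \<in> generated_star_algebra A (x ` I)"
proof -
  have sub: "star_subalgebra (generated_star_algebra A (x ` I)) A"
    using x by (intro A.generated_star_subalgebra) auto
  show ?thesis
    using assms
  proof induction
    case (monomial w)
    then show ?case
    proof (induction w)
      case Nil
      then show ?case by (simp add: star_monomial_def A.one_in_generated)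
    next
      case (Cons p w)
      then obtain i b where p: "p = (i, b)" "i \<in> I" by (cases p) auto
      have "x i \<in> generated_star_algebra A (x ` I)"
        using generated_incl p(2) by fast
      then have "(if b then adj A (x i) else x i) \<in> generated_star_algebra A (x ` I)"
        using star_subalgebraD(5)[OF sub] by simp
      then show ?case
        using Cons star_subalgebraD(4)[OF sub] by (simp add: star_monomial_def p(1))
    qed
  qed (use star_subalgebraD[OF sub] in auto)
qed

text \<open>Both functionals are linear and corresponding elements are built from monomials linearly,
  so it suffices to evaluate the equal distributions at single monomials.\<close>

lemma corr_state:
  assumes "corr a c"
    and dist: "star_distribution A \<phi> I x = star_distribution K \<psi> I y"
    and \<phi>: "\<And>a b. \<lbrakk>a \<in> carrier A; b \<in> carrier A\<rbrakk> \<Longrightarrow> \<phi> (a \<oplus>\<^bsub>A\<^esub> b) = \<phi> a + \<phi> b"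
      "\<And>z a. a \<in> carrier A \<Longrightarrow> \<phi> (z \<odot>\<^bsub>A\<^esub> a) = z * \<phi> a"
    and \<psi>: "\<And>a b. \<lbrakk>a \<in> carrier K; b \<in> carrier K\<rbrakk> \<Longrightarrow> \<psi> (a \<oplus>\<^bsub>K\<^esub> b) = \<psi> a + \<psi> b"
      "\<And>z a. a \<in> carrier K \<Longrightarrow> \<psi> (z \<odot>\<^bsub>K\<^esub> a) = z * \<psi> a"
  shows "\<phi> a = \<psi> c"
  using assms(1)
proof induction
  case (monomial w)
  then have "Poly_Mapping.single w 1 \<in> star_polynomials I"
    by (simp add: star_polynomials_def)
  then have "\<phi> (eval_star_polynomial A x (Poly_Mapping.single w 1))
      = \<psi> (eval_star_polynomial K y (Poly_Mapping.single w 1))"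
    using fun_cong[OF dist, of "Poly_Mapping.single w 1"] by (simp add: star_distribution_def)
  then show ?case
    by (simp only: A.eval_single[OF x monomial] K.eval_single[OF y monomial])
qed (use \<phi> \<psi> corr_closed in auto)

end

section \<open>Matrix units\<close>

lemma finsum_complex_alg: "finsum complex_alg f S = sum f S"
proof -
  interpret star_algebra complex_alg by (rule star_algebra_complex_alg)
  show ?thesis
    by (induction S rule: infinite_finite_induct) simp_all
qed

lemma mat_unit_entry:
  "\<lbrakk>p \<in> {1..n}; q \<in> {1..n}\<rbrakk> \<Longrightarrow> mat_unit n complex_alg i j (p, q) = (if p = i \<and> q = j then 1 else 0)"
  by (simp add: mat_unit_def)

lemma mat_unit_closed: "mat_unit n complex_alg i j \<in> carrier (mat_alg n complex_alg)"
  by (simp add: mat_carrier_iff mat_unit_def)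

text \<open>The rule \<open>e\<^sub>i\<^sub>j m e\<^sub>k\<^sub>l = m\<^sub>j\<^sub>k e\<^sub>i\<^sub>l\<close>. It contains the multiplication rule for matrix units
  (for \<open>m = 1\<close>) and identifies the compressions of a scalar matrix as its entries.\<close>
lemma mat_unit_sandwich:
  assumes "j \<in> {1..n}" "k \<in> {1..n}"
  shows "mat_unit n complex_alg i j \<otimes>\<^bsub>mat_alg n complex_alg\<^esub> m
      \<otimes>\<^bsub>mat_alg n complex_alg\<^esub> mat_unit n complex_alg k l
    = m (j, k) \<odot>\<^bsub>mat_alg n complex_alg\<^esub> mat_unit n complex_alg i l"
proof (rule mat_eqI[where n = n])
  fix p q assume pq: "p \<in> {1..n}" "q \<in> {1..n}"
  have left: "(mat_unit n complex_alg i j \<otimes>\<^bsub>mat_alg n complex_alg\<^esub> m) (p, b)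
      = (if p = i then m (j, b) else 0)" if "b \<in> {1..n}" for b
  proof -
    have "(mat_unit n complex_alg i j \<otimes>\<^bsub>mat_alg n complex_alg\<^esub> m) (p, b)
        = (\<Sum>a\<in>{1..n}. if a = j then (if p = i then m (j, b) else 0) else 0)"
      unfolding mat_entry(1)[OF pq(1) that] finsum_complex_alg
      using pq by (intro sum.cong) (auto simp: mat_unit_entry)
    then show ?thesis using assms by simp
  qed
  have "(mat_unit n complex_alg i j \<otimes>\<^bsub>mat_alg n complex_alg\<^esub> m
      \<otimes>\<^bsub>mat_alg n complex_alg\<^esub> mat_unit n complex_alg k l) (p, q)
      = (\<Sum>b\<in>{1..n}. if b = k then (if p = i \<and> q = l then m (j, k) else 0) else 0)"
    unfolding mat_entry(1)[OF pq] finsum_complex_alg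
    using pq by (intro sum.cong) (auto simp: left mat_unit_entry)
  also have "\<dots> = (m (j, k) \<odot>\<^bsub>mat_alg n complex_alg\<^esub> mat_unit n complex_alg i l) (p, q)"
    using pq assms by (simp add: mat_entry mat_unit_entry)
  finally show "(mat_unit n complex_alg i j \<otimes>\<^bsub>mat_alg n complex_alg\<^esub> m
      \<otimes>\<^bsub>mat_alg n complex_alg\<^esub> mat_unit n complex_alg k l) (p, q)
    = (m (j, k) \<odot>\<^bsub>mat_alg n complex_alg\<^esub> mat_unit n complex_alg i l) (p, q)" .
qed (simp_all add: mat_extensional)

lemma adj_mat_unit:
  "adj (mat_alg n complex_alg) (mat_unit n complex_alg i j) = mat_unit n complex_alg j i"
  by (rule mat_eqI[where n = n]) (auto simp: mat_extensional mat_entry(6) mat_unit_entry mat_unit_def)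

text \<open>The image of a complex matrix under the inclusion of \<open>M\<^sub>n(\<complex>)\<close> in \<open>M\<^sub>n(A)\<close>.\<close>
definition scalar_mat ::
    "nat \<Rightarrow> ('a, 'm) star_algebra_scheme \<Rightarrow> (nat \<times> nat \<Rightarrow> complex) \<Rightarrow> nat \<times> nat \<Rightarrow> 'a" where
  "scalar_mat n A m = restrict (\<lambda>p. m p \<odot>\<^bsub>A\<^esub> \<one>\<^bsub>A\<^esub>) (mat_indices n)"

lemma scalar_mat_entry:
  "\<lbrakk>i \<in> {1..n}; j \<in> {1..n}\<rbrakk> \<Longrightarrow> scalar_mat n A m (i, j) = m (i, j) \<odot>\<^bsub>A\<^esub> \<one>\<^bsub>A\<^esub>"
  by (simp add: scalar_mat_def)

lemma (in star_algebra) scalar_mat_closed: "scalar_mat n A m \<in> carrier (mat_alg n A)"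
  by (simp add: mat_carrier_iff scalar_mat_def scaling one_closed)

lemma (in star_algebra) scalar_mat_one:
  "scalar_mat n A \<one>\<^bsub>mat_alg n complex_alg\<^esub> = \<one>\<^bsub>mat_alg n A\<^esub>"
  by (rule mat_eqI[where n = n])
    (simp_all add: mat_extensional mat_extensional(7)[OF scalar_mat_closed] scalar_mat_entry mat_entry(2)
      scaling one_closed)

lemma (in star_prob_space) mat_state_add:
  assumes "X \<in> carrier (mat_alg n A)" "Y \<in> carrier (mat_alg n A)"
  shows "mat_state n \<phi> (X \<oplus>\<^bsub>mat_alg n A\<^esub> Y) = mat_state n \<phi> X + mat_state n \<phi> Y"
proof -
  have "\<phi> ((X \<oplus>\<^bsub>mat_alg n A\<^esub> Y) (i, i)) = \<phi> (X (i, i)) + \<phi> (Y (i, i))" if i: "i \<in> {1..n}" for i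
    unfolding mat_entry(4)[OF i i]
    by (intro state_add mat_entry_closed[OF assms(1) i i] mat_entry_closed[OF assms(2) i i])
  then show ?thesis
    by (simp add: mat_state_def sum.distrib add_divide_distrib)
qed

lemma (in star_prob_space) mat_state_scalar: "mat_state n \<phi> (scalar_mat n A m) = mat_state n (\<lambda>x. x) m"
proof -
  have "\<phi> (scalar_mat n A m (i, i)) = m (i, i)" if i: "i \<in> {1..n}" for i
    by (simp add: scalar_mat_entry[OF i i] state_smult one_closed state_one)
  then show ?thesis by (simp add: mat_state_def)
qed
text \<open>A copy of \<open>M\<^sub>n(\<complex>)\<close> in \<open>C\<close> identifies \<open>C\<close> with the \<open>n \<times> n\<close> matrices over its corner at
  the first diagonal unit: \<open>y\<close> becomes the matrix of its compressions \<open>e\<^sub>1\<^sub>i y e\<^sub>j\<^sub>1\<close>.\<close>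
locale matrix_units = C: star_algebra C
  for C :: "('c, 'm) star_algebra_scheme" +
  fixes n :: nat and \<iota> :: "(nat \<times> nat \<Rightarrow> complex) \<Rightarrow> 'c"
  assumes n: "n \<ge> 1" and hom: "\<iota> \<in> star_hom (mat_alg n complex_alg) C"
begin

abbreviation u :: "nat \<Rightarrow> nat \<Rightarrow> 'c" where
  "u i j \<equiv> \<iota> (mat_unit n complex_alg i j)"

lemma hom_simps:
  "m \<in> carrier (mat_alg n complex_alg) \<Longrightarrow> \<iota> m \<in> carrier C"
  "\<lbrakk>m \<in> carrier (mat_alg n complex_alg); m' \<in> carrier (mat_alg n complex_alg)\<rbrakk> \<Longrightarrow>
     \<iota> (m \<otimes>\<^bsub>mat_alg n complex_alg\<^esub> m') = \<iota> m \<otimes>\<^bsub>C\<^esub> \<iota> m'"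
  "\<lbrakk>m \<in> carrier (mat_alg n complex_alg); m' \<in> carrier (mat_alg n complex_alg)\<rbrakk> \<Longrightarrow>
     \<iota> (m \<oplus>\<^bsub>mat_alg n complex_alg\<^esub> m') = \<iota> m \<oplus>\<^bsub>C\<^esub> \<iota> m'"
  "\<iota> \<one>\<^bsub>mat_alg n complex_alg\<^esub> = \<one>\<^bsub>C\<^esub>"
  "m \<in> carrier (mat_alg n complex_alg) \<Longrightarrow> \<iota> (adj (mat_alg n complex_alg) m) = adj C (\<iota> m)"
  "m \<in> carrier (mat_alg n complex_alg) \<Longrightarrow> \<iota> (c \<odot>\<^bsub>mat_alg n complex_alg\<^esub> m) = c \<odot>\<^bsub>C\<^esub> \<iota> m"
  using hom by (auto simp: star_hom_def ring_hom_def)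

lemma u_closed: "u i j \<in> carrier C"
  by (intro hom_simps mat_unit_closed)

lemma u_sandwich:
  assumes "m \<in> carrier (mat_alg n complex_alg)" "j \<in> {1..n}" "k \<in> {1..n}"
  shows "u i j \<otimes>\<^bsub>C\<^esub> \<iota> m \<otimes>\<^bsub>C\<^esub> u k l = m (j, k) \<odot>\<^bsub>C\<^esub> u i l"
proof -
  interpret M: star_algebra "mat_alg n complex_alg"
    by (rule star_algebra.star_algebra_mat_alg[OF star_algebra_complex_alg])
  have "u i j \<otimes>\<^bsub>C\<^esub> \<iota> m \<otimes>\<^bsub>C\<^esub> u k l = \<iota> (mat_unit n complex_alg i j
      \<otimes>\<^bsub>mat_alg n complex_alg\<^esub> m \<otimes>\<^bsub>mat_alg n complex_alg\<^esub> mat_unit n complex_alg k l)"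
    by (simp only: hom_simps M.m_closed mat_unit_closed assms(1))
  then show ?thesis
    by (simp only: mat_unit_sandwich[OF assms(2,3)] hom_simps(6) mat_unit_closed)
qed

lemma u_mult:
  assumes "j \<in> {1..n}"
  shows "u i j \<otimes>\<^bsub>C\<^esub> u j l = u i l"
proof -
  interpret M: star_algebra "mat_alg n complex_alg"
    by (rule star_algebra.star_algebra_mat_alg[OF star_algebra_complex_alg])
  have "u i j \<otimes>\<^bsub>C\<^esub> \<iota> \<one>\<^bsub>mat_alg n complex_alg\<^esub> \<otimes>\<^bsub>C\<^esub> u j l = 1 \<odot>\<^bsub>C\<^esub> u i l"
    using u_sandwich[OF M.one_closed assms assms, of i l] assms by (simp add: mat_entry(2))
  then show ?thesis
    by (simp add: hom_simps(4) C.scaling u_closed)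
qed

lemma adj_u: "adj C (u i j) = u j i"
  by (simp only: hom_simps(5)[OF mat_unit_closed, symmetric] adj_mat_unit)

text \<open>Proved for partial sums over \<open>S \<subseteq> {1..n}\<close>: they are the images of the diagonal \<open>0\<close>-\<open>1\<close>
  matrices supported on \<open>S\<close>.\<close>
lemma sum_u: "(\<Oplus>\<^bsub>C\<^esub>k\<in>{1..n}. u k k) = \<one>\<^bsub>C\<^esub>"
proof -
  interpret M: star_algebra "mat_alg n complex_alg"
    by (rule star_algebra.star_algebra_mat_alg[OF star_algebra_complex_alg])
  define d where "d S = restrict (\<lambda>(i, j). if i = j \<and> i \<in> S then 1 else 0 :: complex) (mat_indices n)"
    for S :: "nat set"
  have dc: "d S \<in> carrier (mat_alg n complex_alg)" for S
    by (simp add: mat_carrier_iff d_def)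
  have "(\<Oplus>\<^bsub>C\<^esub>k\<in>S. u k k) = \<iota> (d S)" if "finite S" for S
    using that
  proof (induction S)
    case empty
    have "d {} = 0 \<odot>\<^bsub>mat_alg n complex_alg\<^esub> d {}"
      by (rule mat_eqI[where n = n]) (simp_all add: mat_extensional mat_extensional(7)[OF dc] mat_entry(5) d_def)
    then have "\<iota> (d {}) = 0 \<odot>\<^bsub>C\<^esub> \<iota> (d {})"
      using hom_simps(6)[OF dc, of 0 "{}"] by simp
    then show ?case
      using hom_simps(1)[OF dc] by (simp add: C.scaling)
  next
    case (insert k S)
    have "d (insert k S) = mat_unit n complex_alg k k \<oplus>\<^bsub>mat_alg n complex_alg\<^esub> d S"
      using insert.hyps(2)
      by (intro mat_eqI[where n = n])
        (auto simp: mat_extensional mat_extensional(7)[OF dc] mat_entry(4) mat_unit_entry d_def)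
    then show ?case
      using insert by (simp add: u_closed hom_simps(3) dc mat_unit_closed)
  qed
  moreover have "d {1..n} = \<one>\<^bsub>mat_alg n complex_alg\<^esub>"
    by (intro mat_eqI[where n = n])
      (auto simp: mat_extensional mat_extensional(7)[OF dc] mat_entry(2) d_def)
  ultimately show ?thesis
    by (simp add: hom_simps(4))
qed

lemma one_index: "1 \<in> {1..n}"
  using n by simp

lemma corner_projection: "u 1 1 \<in> carrier C" "u 1 1 \<otimes>\<^bsub>C\<^esub> u 1 1 = u 1 1" "adj C (u 1 1) = u 1 1"
  by (rule u_closed, rule u_mult[OF one_index], rule adj_u)

lemma compression_in_corner:
  assumes "y \<in> carrier C"
  shows "u 1 i \<otimes>\<^bsub>C\<^esub> y \<otimes>\<^bsub>C\<^esub> u j 1 \<in> carrier (corner C (u 1 1))"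
proof -
  have "u 1 1 \<otimes>\<^bsub>C\<^esub> (u 1 i \<otimes>\<^bsub>C\<^esub> y \<otimes>\<^bsub>C\<^esub> u j 1) = (u 1 1 \<otimes>\<^bsub>C\<^esub> u 1 i) \<otimes>\<^bsub>C\<^esub> y \<otimes>\<^bsub>C\<^esub> u j 1"
    "(u 1 i \<otimes>\<^bsub>C\<^esub> y \<otimes>\<^bsub>C\<^esub> u j 1) \<otimes>\<^bsub>C\<^esub> u 1 1 = u 1 i \<otimes>\<^bsub>C\<^esub> y \<otimes>\<^bsub>C\<^esub> (u j 1 \<otimes>\<^bsub>C\<^esub> u 1 1)"
    using assms by (simp_all add: C.m_assoc u_closed)
  then show ?thesis
    unfolding C.corner_carrier_iff[OF corner_projection(1,2)]
    using assms by (simp only: u_mult[OF one_index] C.m_closed u_closed simp_thms)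
qed

text \<open>Compression is multiplicative, since \<open>e\<^sub>k\<^sub>1 e\<^sub>1\<^sub>k = e\<^sub>k\<^sub>k\<close> and these sum to the unit.\<close>
lemma compression_mult:
  assumes "y \<in> carrier C" "y' \<in> carrier C"
  shows "(\<Oplus>\<^bsub>corner C (u 1 1)\<^esub>k\<in>{1..n}. (u 1 i \<otimes>\<^bsub>C\<^esub> y \<otimes>\<^bsub>C\<^esub> u k 1) \<otimes>\<^bsub>C\<^esub> (u 1 k \<otimes>\<^bsub>C\<^esub> y' \<otimes>\<^bsub>C\<^esub> u j 1))
    = u 1 i \<otimes>\<^bsub>C\<^esub> (y \<otimes>\<^bsub>C\<^esub> y') \<otimes>\<^bsub>C\<^esub> u j 1"
proof -
  interpret K: star_algebra "corner C (u 1 1)"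
    by (rule C.star_algebra_corner[OF corner_projection])
  let ?x = "u 1 i \<otimes>\<^bsub>C\<^esub> y" and ?z = "y' \<otimes>\<^bsub>C\<^esub> u j 1"
  have x: "?x \<in> carrier C" and z: "?z \<in> carrier C"
    using assms by (simp_all add: u_closed)
  have mid: "(u 1 i \<otimes>\<^bsub>C\<^esub> y \<otimes>\<^bsub>C\<^esub> u k 1) \<otimes>\<^bsub>C\<^esub> (u 1 k \<otimes>\<^bsub>C\<^esub> y' \<otimes>\<^bsub>C\<^esub> u j 1)
      = ?x \<otimes>\<^bsub>C\<^esub> u k k \<otimes>\<^bsub>C\<^esub> ?z" for k
  proof -
    have "(u 1 i \<otimes>\<^bsub>C\<^esub> y \<otimes>\<^bsub>C\<^esub> u k 1) \<otimes>\<^bsub>C\<^esub> (u 1 k \<otimes>\<^bsub>C\<^esub> y' \<otimes>\<^bsub>C\<^esub> u j 1)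
        = ?x \<otimes>\<^bsub>C\<^esub> (u k 1 \<otimes>\<^bsub>C\<^esub> u 1 k) \<otimes>\<^bsub>C\<^esub> ?z"
      using assms by (simp add: C.m_assoc u_closed)
    then show ?thesis by (simp only: u_mult[OF one_index])
  qed
  have "(\<Oplus>\<^bsub>corner C (u 1 1)\<^esub>k\<in>{1..n}. (u 1 i \<otimes>\<^bsub>C\<^esub> y \<otimes>\<^bsub>C\<^esub> u k 1) \<otimes>\<^bsub>C\<^esub> (u 1 k \<otimes>\<^bsub>C\<^esub> y' \<otimes>\<^bsub>C\<^esub> u j 1))
      = (\<Oplus>\<^bsub>C\<^esub>k\<in>{1..n}. (u 1 i \<otimes>\<^bsub>C\<^esub> y \<otimes>\<^bsub>C\<^esub> u k 1) \<otimes>\<^bsub>C\<^esub> (u 1 k \<otimes>\<^bsub>C\<^esub> y' \<otimes>\<^bsub>C\<^esub> u j 1))"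
    using K.m_closed[OF compression_in_corner[OF assms(1)] compression_in_corner[OF assms(2)]]
    by (intro C.finsum_corner[OF corner_projection] funcsetI) (simp only: corner_simps(1))
  also have "\<dots> = (\<Oplus>\<^bsub>C\<^esub>k\<in>{1..n}. ?x \<otimes>\<^bsub>C\<^esub> u k k \<otimes>\<^bsub>C\<^esub> ?z)"
    by (simp only: mid)
  also have "\<dots> = (\<Oplus>\<^bsub>C\<^esub>k\<in>{1..n}. ?x \<otimes>\<^bsub>C\<^esub> u k k) \<otimes>\<^bsub>C\<^esub> ?z"
    using x z by (intro C.finsum_ldistr[symmetric]) (auto simp: u_closed)
  also have "(\<Oplus>\<^bsub>C\<^esub>k\<in>{1..n}. ?x \<otimes>\<^bsub>C\<^esub> u k k) = ?x \<otimes>\<^bsub>C\<^esub> (\<Oplus>\<^bsub>C\<^esub>k\<in>{1..n}. u k k)"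
    using x by (intro C.finsum_rdistr[symmetric]) (auto simp: u_closed)
  also have "\<dots> = ?x"
    using x by (simp add: sum_u)
  also have "?x \<otimes>\<^bsub>C\<^esub> ?z = u 1 i \<otimes>\<^bsub>C\<^esub> (y \<otimes>\<^bsub>C\<^esub> y') \<otimes>\<^bsub>C\<^esub> u j 1"
    using assms by (simp add: C.m_assoc u_closed)
  finally show ?thesis .
qed

end

section \<open>Matrices with the Brown distribution\<close>

text \<open>The matrix \<open>v\<close> over \<open>A\<close> has entries distributed as the compressions of an element \<open>w\<close> of
  \<open>C\<close> that lies in a set \<open>W\<close> free from the matrix units. The functional on the corner is
  normalised to send its unit to \<open>1\<close>. For the Brown algebra, \<open>W\<close> is the image of \<open>C(\<bbbT>)\<close> and
  \<open>w\<close> that of its generator.\<close>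
locale brown_copy = matrix_units C n \<iota> + C: star_prob_space C \<psi> + A: star_prob_space A \<phi>
  for C :: "('c, 'm) star_algebra_scheme" and n \<iota> \<psi>
    and A :: "('a, 'k) star_algebra_scheme" and \<phi> +
  fixes W :: "'c set" and w :: 'c and v :: "nat \<times> nat \<Rightarrow> 'a"
  assumes W: "W \<subseteq> carrier C" and w: "w \<in> W" and v: "v \<in> carrier (mat_alg n A)"
    and trace: "m \<in> carrier (mat_alg n complex_alg) \<Longrightarrow> \<psi> (\<iota> m) = mat_state n (\<lambda>x. x) m"
    and free: "star_free C \<psi> (\<iota> ` carrier (mat_alg n complex_alg)) W"
    and distribution: "star_distribution A \<phi> (mat_indices n) v =
      star_distribution (corner C (\<iota> (mat_unit n complex_alg 1 1))) (\<lambda>x. of_nat n * \<psi> x) (mat_indices n)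
        (\<lambda>(i, j). \<iota> (mat_unit n complex_alg 1 i) \<otimes>\<^bsub>C\<^esub> w \<otimes>\<^bsub>C\<^esub> \<iota> (mat_unit n complex_alg j 1))"
begin

abbreviation K :: "('c, 'm) star_algebra_scheme" where
  "K \<equiv> corner C (u 1 1)"

sublocale two_families A K "mat_indices n" v "\<lambda>(i, j). u 1 i \<otimes>\<^bsub>C\<^esub> w \<otimes>\<^bsub>C\<^esub> u j 1"
proof (intro two_families.intro two_families_axioms.intro)
  show "star_algebra A" ..
  show "star_algebra K" by (rule C.star_algebra_corner[OF corner_projection])
  show "v \<in> mat_indices n \<rightarrow> carrier A"
    using v by (auto simp: mat_carrier_iff)
  show "(\<lambda>(i, j). u 1 i \<otimes>\<^bsub>C\<^esub> w \<otimes>\<^bsub>C\<^esub> u j 1) \<in> mat_indices n \<rightarrow> carrier K"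
    using compression_in_corner w W by (auto simp del: corner_simps)
qed

sublocale M: star_algebra "mat_alg n A"
  by (rule A.star_algebra_mat_alg)

text \<open>The matrix \<open>X\<close> over \<open>A\<close> is modelled by \<open>y\<close>: its entries and the compressions of \<open>y\<close> are
  the same polynomials in the entries of \<open>v\<close> and in the compressions of \<open>w\<close>, respectively.
  This relation plays the part of a homomorphism from the polynomials in \<open>w\<close> and the matrix units
  to \<open>M\<^sub>n(A)\<close>.\<close>
definition lifts :: "(nat \<times> nat \<Rightarrow> 'a) \<Rightarrow> 'c \<Rightarrow> bool" where
  "lifts X y \<longleftrightarrow> X \<in> carrier (mat_alg n A) \<and> y \<in> carrier C \<and>
     (\<forall>i\<in>{1..n}. \<forall>j\<in>{1..n}. corr (X (i, j)) (u 1 i \<otimes>\<^bsub>C\<^esub> y \<otimes>\<^bsub>C\<^esub> u j 1))"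

lemma lifts_closed: "lifts X y \<Longrightarrow> X \<in> carrier (mat_alg n A)" "lifts X y \<Longrightarrow> y \<in> carrier C"
  by (simp_all add: lifts_def)

lemma lifts_corr:
  "\<lbrakk>lifts X y; i \<in> {1..n}; j \<in> {1..n}\<rbrakk> \<Longrightarrow> corr (X (i, j)) (u 1 i \<otimes>\<^bsub>C\<^esub> y \<otimes>\<^bsub>C\<^esub> u j 1)"
  by (simp add: lifts_def)

lemma lifts_v: "lifts v w"
  unfolding lifts_def
proof (intro conjI ballI)
  fix i j assume "i \<in> {1..n}" "j \<in> {1..n}"
  then show "corr (v (i, j)) (u 1 i \<otimes>\<^bsub>C\<^esub> w \<otimes>\<^bsub>C\<^esub> u j 1)"
    using corr_generator[of "(i, j)"] by simp
qed (use v w W in auto)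

lemma lifts_add:
  assumes "lifts X y" "lifts X' y'"
  shows "lifts (X \<oplus>\<^bsub>mat_alg n A\<^esub> X') (y \<oplus>\<^bsub>C\<^esub> y')"
  unfolding lifts_def
proof (intro conjI ballI)
  note c = lifts_closed[OF assms(1)] lifts_closed[OF assms(2)]
  show "X \<oplus>\<^bsub>mat_alg n A\<^esub> X' \<in> carrier (mat_alg n A)" "y \<oplus>\<^bsub>C\<^esub> y' \<in> carrier C"
    using c by (simp_all only: M.a_closed C.a_closed)
  fix i j assume ij: "i \<in> {1..n}" "j \<in> {1..n}"
  have "u 1 i \<otimes>\<^bsub>C\<^esub> (y \<oplus>\<^bsub>C\<^esub> y') \<otimes>\<^bsub>C\<^esub> u j 1 = (u 1 i \<otimes>\<^bsub>C\<^esub> y \<otimes>\<^bsub>C\<^esub> u j 1) \<oplus>\<^bsub>K\<^esub> (u 1 i \<otimes>\<^bsub>C\<^esub> y' \<otimes>\<^bsub>C\<^esub> u j 1)"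
    using c by (simp add: C.l_distr C.r_distr u_closed)
  then show "corr ((X \<oplus>\<^bsub>mat_alg n A\<^esub> X') (i, j)) (u 1 i \<otimes>\<^bsub>C\<^esub> (y \<oplus>\<^bsub>C\<^esub> y') \<otimes>\<^bsub>C\<^esub> u j 1)"
    using corresponding.add[OF lifts_corr[OF assms(1) ij] lifts_corr[OF assms(2) ij]]
    by (simp only: mat_entry(4)[OF ij])
qed

lemma lifts_smult:
  assumes "lifts X y"
  shows "lifts (c \<odot>\<^bsub>mat_alg n A\<^esub> X) (c \<odot>\<^bsub>C\<^esub> y)"
  unfolding lifts_def
proof (intro conjI ballI)
  note c = lifts_closed[OF assms]
  show "c \<odot>\<^bsub>mat_alg n A\<^esub> X \<in> carrier (mat_alg n A)" "c \<odot>\<^bsub>C\<^esub> y \<in> carrier C"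
    using c by (simp_all only: M.scaling C.scaling)
  fix i j assume ij: "i \<in> {1..n}" "j \<in> {1..n}"
  have "u 1 i \<otimes>\<^bsub>C\<^esub> (c \<odot>\<^bsub>C\<^esub> y) \<otimes>\<^bsub>C\<^esub> u j 1 = c \<odot>\<^bsub>K\<^esub> (u 1 i \<otimes>\<^bsub>C\<^esub> y \<otimes>\<^bsub>C\<^esub> u j 1)"
    using c by (simp add: C.smult_mult_left C.smult_mult_right u_closed)
  then show "corr ((c \<odot>\<^bsub>mat_alg n A\<^esub> X) (i, j)) (u 1 i \<otimes>\<^bsub>C\<^esub> (c \<odot>\<^bsub>C\<^esub> y) \<otimes>\<^bsub>C\<^esub> u j 1)"
    using corresponding.smult[OF lifts_corr[OF assms ij], of c]
    by (simp only: mat_entry(5)[OF ij])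
qed

lemma lifts_mult:
  assumes "lifts X y" "lifts X' y'"
  shows "lifts (X \<otimes>\<^bsub>mat_alg n A\<^esub> X') (y \<otimes>\<^bsub>C\<^esub> y')"
  unfolding lifts_def
proof (intro conjI ballI)
  note c = lifts_closed[OF assms(1)] lifts_closed[OF assms(2)]
  show "X \<otimes>\<^bsub>mat_alg n A\<^esub> X' \<in> carrier (mat_alg n A)" "y \<otimes>\<^bsub>C\<^esub> y' \<in> carrier C"
    using c by (simp_all only: M.m_closed C.m_closed)
  fix i j assume ij: "i \<in> {1..n}" "j \<in> {1..n}"
  have "corr (\<Oplus>\<^bsub>A\<^esub>k\<in>{1..n}. X (i, k) \<otimes>\<^bsub>A\<^esub> X' (k, j))
      (\<Oplus>\<^bsub>K\<^esub>k\<in>{1..n}. (u 1 i \<otimes>\<^bsub>C\<^esub> y \<otimes>\<^bsub>C\<^esub> u k 1) \<otimes>\<^bsub>K\<^esub> (u 1 k \<otimes>\<^bsub>C\<^esub> y' \<otimes>\<^bsub>C\<^esub> u j 1))"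
    by (intro corr_finsum corr_mult lifts_corr assms ij)
  then show "corr ((X \<otimes>\<^bsub>mat_alg n A\<^esub> X') (i, j)) (u 1 i \<otimes>\<^bsub>C\<^esub> (y \<otimes>\<^bsub>C\<^esub> y') \<otimes>\<^bsub>C\<^esub> u j 1)"
    by (simp only: mat_entry(1)[OF ij] corner_simps(1) compression_mult[OF c(2,4)])
qed

lemma lifts_adj:
  assumes "lifts X y"
  shows "lifts (adj (mat_alg n A) X) (adj C y)"
  unfolding lifts_def
proof (intro conjI ballI)
  note c = lifts_closed[OF assms]
  show "adj (mat_alg n A) X \<in> carrier (mat_alg n A)" "adj C y \<in> carrier C"
    using c by (simp_all only: M.adj_closed C.adj_closed)
  fix i j assume ij: "i \<in> {1..n}" "j \<in> {1..n}"
  have "u 1 i \<otimes>\<^bsub>C\<^esub> adj C y \<otimes>\<^bsub>C\<^esub> u j 1 = adj K (u 1 j \<otimes>\<^bsub>C\<^esub> y \<otimes>\<^bsub>C\<^esub> u i 1)"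
    using c by (simp add: C.adj_mult C.adj_closed adj_u u_closed C.m_assoc)
  then show "corr (adj (mat_alg n A) X (i, j)) (u 1 i \<otimes>\<^bsub>C\<^esub> adj C y \<otimes>\<^bsub>C\<^esub> u j 1)"
    using corr_adj[OF lifts_corr[OF assms ij(2,1)]]
    by (simp only: mat_entry(6)[OF ij])
qed

lemma lifts_scalar:
  assumes "m \<in> carrier (mat_alg n complex_alg)"
  shows "lifts (scalar_mat n A m) (\<iota> m)"
  unfolding lifts_def
proof (intro conjI ballI)
  show "scalar_mat n A m \<in> carrier (mat_alg n A)" "\<iota> m \<in> carrier C"
    by (simp_all only: A.scalar_mat_closed hom_simps assms)
  fix i j assume ij: "i \<in> {1..n}" "j \<in> {1..n}"
  show "corr (scalar_mat n A m (i, j)) (u 1 i \<otimes>\<^bsub>C\<^esub> \<iota> m \<otimes>\<^bsub>C\<^esub> u j 1)"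
    using corr_scalar[of "m (i, j)"]
    by (simp only: scalar_mat_entry[OF ij] u_sandwich[OF assms ij] corner_simps)
qed

text \<open>The matrices with a model form a \<open>*\<close>-subalgebra that contains \<open>v\<close>.\<close>
lemma lifts_generated:
  assumes "X \<in> generated_star_algebra (mat_alg n A) {v}"
  obtains y where "y \<in> generated_star_algebra C W" "lifts X y"
proof -
  let ?G = "generated_star_algebra C W"
  note G = star_subalgebraD[OF C.generated_star_subalgebra[OF W]]
  have one: "lifts \<one>\<^bsub>mat_alg n A\<^esub> \<one>\<^bsub>C\<^esub>"
    using lifts_scalar[OF star_algebra.one_closed[OF star_algebra.star_algebra_mat_alg[OF star_algebra_complex_alg]]]
    by (simp only: A.scalar_mat_one hom_simps(4))
  have zero: "lifts \<zero>\<^bsub>mat_alg n A\<^esub> \<zero>\<^bsub>C\<^esub>"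
    using lifts_smult[OF one, of 0] by (simp only: M.scaling M.one_closed C.scaling C.one_closed)
  have "generated_star_algebra (mat_alg n A) {v} \<subseteq> {X. \<exists>y\<in>?G. lifts X y}"
  proof (rule generated_minimal)
    show "{v} \<subseteq> {X. \<exists>y\<in>?G. lifts X y}"
      using lifts_v w generated_incl[of W C] by auto
    show "\<one>\<^bsub>mat_alg n A\<^esub> \<in> {X. \<exists>y\<in>?G. lifts X y}"
      using one C.one_in_generated by auto
    show "star_subalgebra {X. \<exists>y\<in>?G. lifts X y} (mat_alg n A)"
      unfolding star_subalgebra_def
    proof (intro conjI ballI allI)
      show "{X. \<exists>y\<in>?G. lifts X y} \<subseteq> carrier (mat_alg n A)"
        using lifts_closed by auto
      show "\<zero>\<^bsub>mat_alg n A\<^esub> \<in> {X. \<exists>y\<in>?G. lifts X y}"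
        using zero G(2) by auto
      fix X assume "X \<in> {X. \<exists>y\<in>?G. lifts X y}"
      then obtain y where y: "y \<in> ?G" "lifts X y" by auto
      show "adj (mat_alg n A) X \<in> {X. \<exists>y\<in>?G. lifts X y}"
        using lifts_adj[OF y(2)] G(5)[OF y(1)] by auto
      show "c \<odot>\<^bsub>mat_alg n A\<^esub> X \<in> {X. \<exists>y\<in>?G. lifts X y}" for c
        using lifts_smult[OF y(2)] G(6)[OF y(1)] by auto
      fix X' assume "X' \<in> {X. \<exists>y\<in>?G. lifts X y}"
      then obtain y' where y': "y' \<in> ?G" "lifts X' y'" by auto
      show "X \<oplus>\<^bsub>mat_alg n A\<^esub> X' \<in> {X. \<exists>y\<in>?G. lifts X y}"
        using lifts_add[OF y(2) y'(2)] G(3)[OF y(1) y'(1)] by auto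
      show "X \<otimes>\<^bsub>mat_alg n A\<^esub> X' \<in> {X. \<exists>y\<in>?G. lifts X y}"
        using lifts_mult[OF y(2) y'(2)] G(4)[OF y(1) y'(1)] by auto
    qed
  qed
  with assms that show thesis by blast
qed

lemma lifts_state:
  assumes "lifts X y" "i \<in> {1..n}" "j \<in> {1..n}"
  shows "\<phi> (X (i, j)) = of_nat n * \<psi> (u 1 i \<otimes>\<^bsub>C\<^esub> y \<otimes>\<^bsub>C\<^esub> u j 1)"
proof (rule corr_state[OF lifts_corr[OF assms] distribution])
  note iff = C.corner_carrier_iff[OF corner_projection(1,2)]
  fix a b z assume "a \<in> carrier K" "b \<in> carrier K"
  then have "a \<in> carrier C" "b \<in> carrier C"
    by (simp_all only: iff)
  then show "of_nat n * \<psi> (a \<oplus>\<^bsub>K\<^esub> b) = of_nat n * \<psi> a + of_nat n * \<psi> b"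
    by (simp add: C.state_add ring_distribs)
next
  note iff = C.corner_carrier_iff[OF corner_projection(1,2)]
  fix a z assume "a \<in> carrier K"
  then have "a \<in> carrier C"
    by (simp_all only: iff)
  then show "of_nat n * \<psi> (z \<odot>\<^bsub>K\<^esub> a) = z * (of_nat n * \<psi> a)"
    by (simp add: C.state_smult)
qed (simp_all only: A.state_add A.state_smult)

abbreviation U :: "'c set" where
  "U \<equiv> \<iota> ` carrier (mat_alg n complex_alg)"

lemma U_carrier: "U \<subseteq> carrier C"
  using hom_simps(1) by auto

lemma u_generated: "u i j \<in> generated_star_algebra C U"
  using generated_incl[of U C] mat_unit_closed[of n i j] by blast

text \<open>By freeness \<open>\<psi>(e\<^sub>1\<^sub>i y e\<^sub>i\<^sub>1) = \<psi>(y) \<psi>(e\<^sub>1\<^sub>i e\<^sub>i\<^sub>1) = \<psi>(y) \<psi>(e\<^sub>1\<^sub>1) = \<psi>(y) / n\<close>, so that all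
  diagonal entries of \<open>X\<close> have the expectation \<open>\<psi>(y)\<close>. In particular, centred polynomials in \<open>v\<close>
  have centred models.\<close>
lemma lifts_mat_state:
  assumes "lifts X y" "y \<in> generated_star_algebra C W"
  shows "mat_state n \<phi> X = \<psi> y"
proof -
  have u11: "\<psi> (u 1 1) = 1 / of_nat n"
  proof -
    have "(\<Sum>i = 1..n. mat_unit n complex_alg 1 1 (i, i)) = (\<Sum>i = 1..n. if i = 1 then 1 else 0)"
      by (intro sum.cong) (auto simp: mat_unit_entry)
    then show ?thesis
      using n by (simp add: trace mat_unit_closed mat_state_def)
  qed
  have "\<phi> (X (i, i)) = \<psi> y" if i: "i \<in> {1..n}" for i
  proof -
    have "\<phi> (X (i, i)) = of_nat n * (\<psi> y * \<psi> (u 1 i \<otimes>\<^bsub>C\<^esub> u i 1))"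
      by (simp only: lifts_state[OF assms(1) i i]
          C.state_sandwich[OF U_carrier W free assms(2) u_generated u_generated])
    then show ?thesis
      using n by (simp only: u_mult[OF i] u11) simp
  qed
  then have "(\<Sum>i=1..n. \<phi> (X (i, i))) = of_nat n * \<psi> y"
    by simp
  then show ?thesis
    using n by (simp add: mat_state_def)
qed

text \<open>The products \<open>x\<^sub>1 m\<^sub>1 x\<^sub>2 \<dots> m\<^sub>k\<^sub>-\<^sub>1 x\<^sub>k\<close> that remain between two consecutive factors with
  centred entries from \<open>B\<close>, when the factors between them contribute their scalar parts.\<close>
inductive_set runs :: "(nat \<times> nat \<Rightarrow> 'a) set" where
  single: "\<lbrakk>x \<in> generated_star_algebra (mat_alg n A) {v}; mat_state n \<phi> x = 0\<rbrakk> \<Longrightarrow> x \<in> runs"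
| extend: "\<lbrakk>x \<in> generated_star_algebra (mat_alg n A) {v}; mat_state n \<phi> x = 0;
     m \<in> carrier (mat_alg n complex_alg); mat_state n (\<lambda>x. x) m = 0; r \<in> runs\<rbrakk> \<Longrightarrow>
     x \<otimes>\<^bsub>mat_alg n A\<^esub> (scalar_mat n A m \<otimes>\<^bsub>mat_alg n A\<^esub> r) \<in> runs"

text \<open>The model of a run is an alternating centred word that begins and ends with a letter from the
  algebra of \<open>W\<close>: the separating scalar matrices are centred because their trace vanishes.\<close>
lemma runs_lift:
  assumes "r \<in> runs"
  obtains ws where "ws \<in> alternating_words C \<psi> U W" "fst (hd ws)" "fst (last ws)"
    "lifts r (alg_prod C (map snd ws))"
proof -
  have "\<exists>ws\<in>alternating_words C \<psi> U W. fst (hd ws) \<and> fst (last ws) \<and> lifts r (alg_prod C (map snd ws))"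
    using assms
  proof induction
    case (single x)
    obtain y where y: "y \<in> generated_star_algebra C W" "lifts x y"
      using lifts_generated[OF single(1)] .
    have "\<psi> y = 0"
      using lifts_mat_state[OF y(2,1)] single(2) by simp
    then have "[(True, y)] \<in> alternating_words C \<psi> U W"
      using y by (simp add: alternating_words_def)
    moreover have "alg_prod C (map snd [(True, y)]) = y"
      using lifts_closed[OF y(2)] by simp
    ultimately show ?case
      using y(2) by (metis fst_conv last.simps list.sel(1))
  next
    case (extend x m r)
    obtain y where y: "y \<in> generated_star_algebra C W" "lifts x y"
      using lifts_generated[OF extend(1)] .
    have y0: "\<psi> y = 0"
      using lifts_mat_state[OF y(2,1)] extend(2) by simp
    have m0: "\<psi> (\<iota> m) = 0"
      using trace extend(3,4) by simp
    have m: "\<iota> m \<in> generated_star_algebra C U"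
      using generated_incl[of U C] extend(3) by blast
    obtain ws where ws: "ws \<in> alternating_words C \<psi> U W" "fst (hd ws)" "fst (last ws)"
      "lifts r (alg_prod C (map snd ws))"
      using extend.IH by blast
    have "(True, y) # (False, \<iota> m) # ws \<in> alternating_words C \<psi> U W"
      using ws(1,2) y(1) y0 m m0 by (auto simp: alternating_words_def distinct_adj_Cons hd_map)
    moreover have "fst (last ((True, y) # (False, \<iota> m) # ws))"
      using ws(1,3) by (simp add: alternating_words_def)
    moreover have "lifts (x \<otimes>\<^bsub>mat_alg n A\<^esub> (scalar_mat n A m \<otimes>\<^bsub>mat_alg n A\<^esub> r))
        (alg_prod C (map snd ((True, y) # (False, \<iota> m) # ws)))"
      using lifts_mult[OF y(2) lifts_mult[OF lifts_scalar[OF extend(3)] ws(4)]] by simp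
    ultimately show ?case
      by (metis fst_conv list.sel(1))
  qed
  with that show thesis by blast
qed

lemma runs_closed: "r \<in> runs \<Longrightarrow> r \<in> carrier (mat_alg n A)"
  using runs_lift lifts_closed(1) by metis

text \<open>The \<open>(i, j)\<close> entry of a run has the expectation \<open>n \<psi>(e\<^sub>1\<^sub>i z e\<^sub>j\<^sub>1)\<close>, where \<open>z\<close> is the
  alternating word that models the run, and this is zero by freeness in \<open>C\<close>. All entries are
  centred, not just their average over the diagonal.\<close>
lemma runs_entry:
  assumes "r \<in> runs" "i \<in> {1..n}" "j \<in> {1..n}"
  shows "r (i, j) \<in> generated_star_algebra A (v ` mat_indices n)" "\<phi> (r (i, j)) = 0"
proof -
  obtain ws where ws: "ws \<in> alternating_words C \<psi> U W" "fst (hd ws)" "fst (last ws)"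
    "lifts r (alg_prod C (map snd ws))"
    using runs_lift[OF assms(1)] .
  show "r (i, j) \<in> generated_star_algebra A (v ` mat_indices n)"
    by (rule corr_generated[OF lifts_corr[OF ws(4) assms(2,3)]])
  show "\<phi> (r (i, j)) = 0"
    by (simp only: lifts_state[OF ws(4) assms(2,3)] mult_zero_right
        C.state_sandwich_word[OF U_carrier W free ws(1-3) u_generated u_generated])
qed

end

section \<open>Freeness from matrices over a free subalgebra\<close>

locale brown_copy_free = brown_copy C n \<iota> \<psi> A \<phi> W w v
  for C :: "('c, 'm) star_algebra_scheme" and n \<iota> \<psi>
    and A :: "('a, 'k) star_algebra_scheme" and \<phi> W w v +
  fixes B :: "'a set"
  assumes B: "star_subalgebra B A" and B_free: "star_free A \<phi> B (v ` mat_indices n)"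
begin

abbreviation V :: "'a set" where "V \<equiv> v ` mat_indices n"

abbreviation span :: "bool \<Rightarrow> 'a set" where "span \<equiv> alternating_span A \<phi> B V"

lemma BV_carrier: "B \<subseteq> carrier A" "V \<subseteq> carrier A"
  using star_subalgebraD(1)[OF B] x by auto

abbreviation MB :: "(nat \<times> nat \<Rightarrow> 'a) set" where
  "MB \<equiv> carrier (mat_alg n (A\<lparr>carrier := B\<rparr>))"

abbreviation span_mat :: "bool \<Rightarrow> (nat \<times> nat \<Rightarrow> 'a) set" where
  "span_mat b \<equiv> {X \<in> carrier (mat_alg n A). \<forall>i\<in>{1..n}. \<forall>j\<in>{1..n}. X (i, j) \<in> span b}"

text \<open>Entrywise, a matrix product is a sum of products of entries, so multiplication by a matrix of
  centred letters of kind \<open>b\<close> prepends such a letter to alternating words of the other kind.\<close>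
lemma span_mat_mult:
  assumes X: "X \<in> carrier (mat_alg n A)"
    and entries: "\<And>i j. \<lbrakk>i \<in> {1..n}; j \<in> {1..n}\<rbrakk> \<Longrightarrow>
      X (i, j) \<in> generated_star_algebra A (if b then V else B) \<and> \<phi> (X (i, j)) = 0"
    and Y: "Y \<in> span_mat (\<not> b)"
  shows "X \<otimes>\<^bsub>mat_alg n A\<^esub> Y \<in> span_mat b"
proof (intro CollectI conjI ballI)
  show "X \<otimes>\<^bsub>mat_alg n A\<^esub> Y \<in> carrier (mat_alg n A)"
    using X Y by (simp only: M.m_closed mem_Collect_eq)
  fix i j assume ij: "i \<in> {1..n}" "j \<in> {1..n}"
  show "(X \<otimes>\<^bsub>mat_alg n A\<^esub> Y) (i, j) \<in> span b"
    unfolding mat_entry(1)[OF ij]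
    using entries Y ij
    by (intro A.alternating_span_finsum[OF BV_carrier] A.alternating_span_mult[OF BV_carrier]) blast+
qed

text \<open>The shape of an alternating word in \<open>v\<close> and \<open>M\<^sub>n(B)\<close>, after every factor from \<open>M\<^sub>n(B)\<close> has
  been split into a matrix with centred entries and a scalar matrix of trace zero. If the first
  factor comes from \<open>v\<close>, the first run is followed by the end of the word, by one last scalar
  matrix, or by alternating words that begin in \<open>B\<close>. In the first case the scalar matrix is the
  unit, which is why its trace is not required to vanish.\<close>
inductive_set v_leading :: "(nat \<times> nat \<Rightarrow> 'a) set" where
  run_scalar: "\<lbrakk>r \<in> runs; m \<in> carrier (mat_alg n complex_alg)\<rbrakk> \<Longrightarrow>
    r \<otimes>\<^bsub>mat_alg n A\<^esub> scalar_mat n A m \<in> v_leading"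
| run_span: "\<lbrakk>r \<in> runs; Y \<in> span_mat False\<rbrakk> \<Longrightarrow> r \<otimes>\<^bsub>mat_alg n A\<^esub> Y \<in> v_leading"
| add: "\<lbrakk>X \<in> v_leading; Y \<in> v_leading\<rbrakk> \<Longrightarrow> X \<oplus>\<^bsub>mat_alg n A\<^esub> Y \<in> v_leading"

text \<open>If the first factor comes from \<open>M\<^sub>n(B)\<close>, it contributes either centred entries from \<open>B\<close> or
  a scalar matrix of trace zero. The latter may be the whole word; then \<open>\<Phi>\<close> vanishes on it,
  although \<open>\<phi>\<close> may not vanish on its entries.\<close>
inductive_set b_leading :: "(nat \<times> nat \<Rightarrow> 'a) set" where
  span: "Y \<in> span_mat False \<Longrightarrow> Y \<in> b_leading"
| scalar: "\<lbrakk>m \<in> carrier (mat_alg n complex_alg); mat_state n (\<lambda>x. x) m = 0\<rbrakk> \<Longrightarrow>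
    scalar_mat n A m \<in> b_leading"
| scalar_mult: "\<lbrakk>m \<in> carrier (mat_alg n complex_alg); mat_state n (\<lambda>x. x) m = 0; X \<in> v_leading\<rbrakk> \<Longrightarrow>
    scalar_mat n A m \<otimes>\<^bsub>mat_alg n A\<^esub> X \<in> b_leading"
| add: "\<lbrakk>X \<in> b_leading; Y \<in> b_leading\<rbrakk> \<Longrightarrow> X \<oplus>\<^bsub>mat_alg n A\<^esub> Y \<in> b_leading"

text \<open>The entries of a run serve as single centred letters. A final scalar matrix only forms linear
  combinations of them.\<close>
lemma v_leading_span: "X \<in> v_leading \<Longrightarrow> X \<in> span_mat True"
proof (induction rule: v_leading.induct)
  case (run_scalar r m)
  show ?case
  proof (intro CollectI conjI ballI)
    show "r \<otimes>\<^bsub>mat_alg n A\<^esub> scalar_mat n A m \<in> carrier (mat_alg n A)"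
      by (intro M.m_closed runs_closed run_scalar A.scalar_mat_closed)
    fix i j assume ij: "i \<in> {1..n}" "j \<in> {1..n}"
    note V = star_subalgebraD[OF A.generated_star_subalgebra[OF BV_carrier(2)]]
    show "(r \<otimes>\<^bsub>mat_alg n A\<^esub> scalar_mat n A m) (i, j) \<in> span True"
      unfolding mat_entry(1)[OF ij]
    proof (intro A.alternating_span_finsum[OF BV_carrier] A.alternating_span_letter[OF BV_carrier])
      fix k assume k: "k \<in> {1..n}"
      note r = runs_entry[OF run_scalar(1) ij(1) k]
      have "r (i, k) \<otimes>\<^bsub>A\<^esub> scalar_mat n A m (k, j) = m (k, j) \<odot>\<^bsub>A\<^esub> r (i, k)"
        using V(1)[OF r(1)] k ij
        by (simp add: scalar_mat_entry A.smult_mult_right A.one_closed)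
      then show "r (i, k) \<otimes>\<^bsub>A\<^esub> scalar_mat n A m (k, j)
          \<in> generated_star_algebra A (if True then V else B)"
        "\<phi> (r (i, k) \<otimes>\<^bsub>A\<^esub> scalar_mat n A m (k, j)) = 0"
        using r V(1)[OF r(1)] V(6)[OF r(1)] by (simp_all add: A.state_smult)
    qed
  qed
next
  case (run_span r Y)
  show ?case
    by (rule span_mat_mult) (use run_span runs_closed runs_entry in auto)
next
  case (add X Y)
  then show ?case
    using alternating_span.add[where b = True and A = A and \<phi> = \<phi> and S = B and T = V]
    by (simp add: mat_entry(4))
qed

lemma v_leading_state:
  assumes "X \<in> v_leading" "i \<in> {1..n}" "j \<in> {1..n}"
  shows "X (i, j) \<in> carrier A" "\<phi> (X (i, j)) = 0"
  using v_leading_span[OF assms(1)] assms(2,3)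
    A.alternating_span_state[OF BV_carrier B_free] A.alternating_span_carrier[OF BV_carrier]
  by blast+

lemma b_leading_closed: "X \<in> b_leading \<Longrightarrow> X \<in> carrier (mat_alg n A)"
proof (induction rule: b_leading.induct)
  case (scalar_mult m X)
  then show ?case using v_leading_span by (intro M.m_closed A.scalar_mat_closed) blast
next
  case (add X Y)
  show ?case by (intro M.a_closed add.IH)
qed (auto simp: A.scalar_mat_closed)

lemma b_leading_state: "X \<in> b_leading \<Longrightarrow> mat_state n \<phi> X = 0"
proof (induction rule: b_leading.induct)
  case (span Y)
  then have "\<phi> (Y (i, i)) = 0" if "i \<in> {1..n}" for i
    using A.alternating_span_state[OF BV_carrier B_free] that by blast
  then show ?case by (simp add: mat_state_def)
next
  case (scalar m)
  then show ?case by (simp add: A.mat_state_scalar)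
next
  case (scalar_mult m X)
  have "\<phi> ((scalar_mat n A m \<otimes>\<^bsub>mat_alg n A\<^esub> X) (i, i)) = 0" if i: "i \<in> {1..n}" for i
  proof -
    have t: "scalar_mat n A m (i, k) \<otimes>\<^bsub>A\<^esub> X (k, i) \<in> carrier A"
      "\<phi> (scalar_mat n A m (i, k) \<otimes>\<^bsub>A\<^esub> X (k, i)) = 0" if k: "k \<in> {1..n}" for k
      using v_leading_state[OF scalar_mult(3) k i]
      by (simp_all add: scalar_mat_entry[OF i k] A.smult_mult_left A.one_closed A.scaling A.state_smult)
    then show ?thesis
      unfolding mat_entry(1)[OF i i] by (subst A.state_finsum) auto
  qed
  then show ?case by (simp add: mat_state_def)
next
  case (add X Y)
  then show ?case by (simp add: A.mat_state_add b_leading_closed)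
qed

text \<open>A polynomial in \<open>v\<close> and a scalar matrix in front of a run merge with it into a longer run.\<close>
lemma scalar_runs_v_leading:
  assumes x: "x \<in> generated_star_algebra (mat_alg n A) {v}" "mat_state n \<phi> x = 0"
    and m: "m \<in> carrier (mat_alg n complex_alg)" "mat_state n (\<lambda>x. x) m = 0"
    and X: "X \<in> v_leading"
  shows "x \<otimes>\<^bsub>mat_alg n A\<^esub> (scalar_mat n A m \<otimes>\<^bsub>mat_alg n A\<^esub> X) \<in> v_leading"
proof -
  have xc: "x \<in> carrier (mat_alg n A)" by (rule runs_closed[OF runs.single[OF x]])
  note sc = A.scalar_mat_closed[of n]
  have assoc: "x \<otimes>\<^bsub>mat_alg n A\<^esub> (scalar_mat n A m \<otimes>\<^bsub>mat_alg n A\<^esub> (r \<otimes>\<^bsub>mat_alg n A\<^esub> Y))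
      = (x \<otimes>\<^bsub>mat_alg n A\<^esub> (scalar_mat n A m \<otimes>\<^bsub>mat_alg n A\<^esub> r)) \<otimes>\<^bsub>mat_alg n A\<^esub> Y"
    if "r \<in> carrier (mat_alg n A)" "Y \<in> carrier (mat_alg n A)" for r Y
    by (simp only: M.m_assoc M.m_closed xc sc that)
  show ?thesis
    using X
  proof (induction rule: v_leading.induct)
    case (run_scalar r m')
    show ?case
      unfolding assoc[OF runs_closed[OF run_scalar(1)] sc]
      by (intro v_leading.run_scalar runs.extend x m run_scalar)
  next
    case (run_span r Y)
    then have Y: "Y \<in> carrier (mat_alg n A)" by blast
    show ?case
      unfolding assoc[OF runs_closed[OF run_span(1)] Y]
      by (intro v_leading.run_span runs.extend x m run_span)
  next
    case (add X Y)
    have c: "X \<in> carrier (mat_alg n A)" "Y \<in> carrier (mat_alg n A)"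
      using v_leading_span[OF add(1)] v_leading_span[OF add(2)] by blast+
    have "x \<otimes>\<^bsub>mat_alg n A\<^esub> (scalar_mat n A m \<otimes>\<^bsub>mat_alg n A\<^esub> (X \<oplus>\<^bsub>mat_alg n A\<^esub> Y))
      = x \<otimes>\<^bsub>mat_alg n A\<^esub> (scalar_mat n A m \<otimes>\<^bsub>mat_alg n A\<^esub> X)
        \<oplus>\<^bsub>mat_alg n A\<^esub> x \<otimes>\<^bsub>mat_alg n A\<^esub> (scalar_mat n A m \<otimes>\<^bsub>mat_alg n A\<^esub> Y)"
      by (simp only: M.r_distr M.m_closed xc sc c)
    then show ?case by (simp only: v_leading.add add.IH)
  qed
qed

lemma v_times_b_leading:
  assumes x: "x \<in> generated_star_algebra (mat_alg n A) {v}" "mat_state n \<phi> x = 0"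
    and X: "X \<in> b_leading"
  shows "x \<otimes>\<^bsub>mat_alg n A\<^esub> X \<in> v_leading"
proof -
  have xr: "x \<in> runs" by (rule runs.single[OF x])
  show ?thesis
    using X
  proof (induction rule: b_leading.induct)
    case (span Y)
    show ?case by (rule v_leading.run_span[OF xr span])
  next
    case (scalar m)
    show ?case by (rule v_leading.run_scalar[OF xr scalar(1)])
  next
    case (scalar_mult m X)
    show ?case by (rule scalar_runs_v_leading[OF x scalar_mult])
  next
    case (add X Y)
    then show ?case
      by (simp only: M.r_distr runs_closed[OF xr] b_leading_closed v_leading.add)
  qed
qed

text \<open>If \<open>B\<close> does not contain the unit of \<open>A\<close>, centring the entries of a matrix over \<open>B\<close> leads
  out of \<open>M\<^sub>n(B)\<close>, but not out of the matrices over the unital algebra generated by \<open>B\<close>.\<close>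
lemma generated_MB_entry:
  assumes "b \<in> generated_star_algebra (mat_alg n A) MB" "i \<in> {1..n}" "j \<in> {1..n}"
  shows "b (i, j) \<in> generated_star_algebra A B"
proof -
  let ?Q = "generated_star_algebra A B"
  note Q = A.generated_star_subalgebra[OF BV_carrier(1)]
  have "generated_star_algebra (mat_alg n A) MB \<subseteq> carrier (mat_alg n (A\<lparr>carrier := ?Q\<rparr>))"
  proof (rule generated_minimal)
    show "MB \<subseteq> carrier (mat_alg n (A\<lparr>carrier := ?Q\<rparr>))"
      unfolding subset_iff A.mat_over_subset_iff using generated_incl[of B A] by blast
    show "star_subalgebra (carrier (mat_alg n (A\<lparr>carrier := ?Q\<rparr>))) (mat_alg n A)"
      by (rule A.mat_star_subalgebra[OF Q])
    show "\<one>\<^bsub>mat_alg n A\<^esub> \<in> carrier (mat_alg n (A\<lparr>carrier := ?Q\<rparr>))"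
      unfolding A.mat_over_subset_iff
      using A.one_in_generated star_subalgebraD(2)[OF Q] by (simp add: mat_extensional mat_entry(2))
  qed
  then show ?thesis
    using assms unfolding subset_iff A.mat_over_subset_iff by blast
qed

text \<open>Centre every entry; the scalar matrix \<open>m\<close> of expectations satisfies \<open>tr(m) = \<Phi>(b) = 0\<close>.\<close>
lemma generated_MB_split:
  assumes "b \<in> generated_star_algebra (mat_alg n A) MB" "mat_state n \<phi> b = 0"
  obtains b' m where "b' \<in> carrier (mat_alg n A)"
    "\<And>i j. \<lbrakk>i \<in> {1..n}; j \<in> {1..n}\<rbrakk> \<Longrightarrow>
      b' (i, j) \<in> generated_star_algebra A B \<and> \<phi> (b' (i, j)) = 0"
    "m \<in> carrier (mat_alg n complex_alg)" "mat_state n (\<lambda>x. x) m = 0"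
    "b = b' \<oplus>\<^bsub>mat_alg n A\<^esub> scalar_mat n A m"
proof -
  note Q = A.generated_star_subalgebra[OF BV_carrier(1)]
  have MBc: "MB \<subseteq> carrier (mat_alg n A)"
    using star_subalgebraD(1)[OF A.mat_star_subalgebra[OF B]] by blast
  have bc: "b \<in> carrier (mat_alg n A)"
    using M.generated_subset_carrier[OF MBc] assms(1) by blast
  define m where "m = restrict (\<lambda>p. \<phi> (b p)) (mat_indices n)"
  have "\<exists>c. c \<in> generated_star_algebra A B \<and> \<phi> c = 0 \<and> b p = c \<oplus>\<^bsub>A\<^esub> (\<phi> (b p) \<odot>\<^bsub>A\<^esub> \<one>\<^bsub>A\<^esub>)"
    if "p \<in> mat_indices n" for p
  proof -
    have "b p \<in> generated_star_algebra A B"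
      using generated_MB_entry[OF assms(1)] that by (cases p) auto
    then show ?thesis
      using A.centring[OF Q A.one_in_generated] by metis
  qed
  then obtain c where c: "c p \<in> generated_star_algebra A B" "\<phi> (c p) = 0"
      "b p = c p \<oplus>\<^bsub>A\<^esub> (\<phi> (b p) \<odot>\<^bsub>A\<^esub> \<one>\<^bsub>A\<^esub>)"
    if "p \<in> mat_indices n" for p
    by metis
  define b' where "b' = restrict c (mat_indices n)"
  have b'e: "b' (i, j) \<in> generated_star_algebra A B \<and> \<phi> (b' (i, j)) = 0"
    if "i \<in> {1..n}" "j \<in> {1..n}" for i j
    using c(1,2)[of "(i, j)"] that by (simp add: b'_def)
  show thesis
  proof (rule that)
    show b'c: "b' \<in> carrier (mat_alg n A)"
      using b'e star_subalgebraD(1)[OF Q] by (auto simp: mat_carrier_iff b'_def)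
    show "m \<in> carrier (mat_alg n complex_alg)"
      by (simp add: mat_carrier_iff m_def)
    show "mat_state n (\<lambda>x. x) m = 0"
      using assms(2) by (simp add: mat_state_def m_def)
    show "b = b' \<oplus>\<^bsub>mat_alg n A\<^esub> scalar_mat n A m"
    proof (rule mat_eqI[where n = n])
      fix i j assume ij: "i \<in> {1..n}" "j \<in> {1..n}"
      then show "b (i, j) = (b' \<oplus>\<^bsub>mat_alg n A\<^esub> scalar_mat n A m) (i, j)"
        using c(3)[of "(i, j)"] by (simp add: mat_entry(4) scalar_mat_entry b'_def m_def)
    qed (simp_all only: mat_extensional mat_extensional(7)[OF bc])
  qed (use b'e in blast)
qed

lemma b_times_v_leading:
  assumes b: "b \<in> generated_star_algebra (mat_alg n A) MB" "mat_state n \<phi> b = 0"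
    and X: "X \<in> v_leading"
  shows "b \<otimes>\<^bsub>mat_alg n A\<^esub> X \<in> b_leading"
proof -
  obtain b' m where b': "b' \<in> carrier (mat_alg n A)"
      "\<And>i j. \<lbrakk>i \<in> {1..n}; j \<in> {1..n}\<rbrakk> \<Longrightarrow>
        b' (i, j) \<in> generated_star_algebra A B \<and> \<phi> (b' (i, j)) = 0"
    and m: "m \<in> carrier (mat_alg n complex_alg)" "mat_state n (\<lambda>x. x) m = 0"
    and eq: "b = b' \<oplus>\<^bsub>mat_alg n A\<^esub> scalar_mat n A m"
    using generated_MB_split[OF b] by metis
  have Xc: "X \<in> carrier (mat_alg n A)" using v_leading_span[OF X] by blast
  have "b' \<otimes>\<^bsub>mat_alg n A\<^esub> X \<in> span_mat False"
    by (rule span_mat_mult[OF b'(1)]) (use b'(2) v_leading_span[OF X] in simp_all)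
  then have "b' \<otimes>\<^bsub>mat_alg n A\<^esub> X \<in> b_leading"
    by (simp add: b_leading.span)
  moreover have "scalar_mat n A m \<otimes>\<^bsub>mat_alg n A\<^esub> X \<in> b_leading"
    by (intro b_leading.scalar_mult m X)
  ultimately show ?thesis
    by (simp only: eq M.l_distr b'(1) A.scalar_mat_closed Xc b_leading.add)
qed

lemma b_in_b_leading:
  assumes b: "b \<in> generated_star_algebra (mat_alg n A) MB" "mat_state n \<phi> b = 0"
  shows "b \<in> b_leading"
proof -
  obtain b' m where b': "b' \<in> carrier (mat_alg n A)"
      "\<And>i j. \<lbrakk>i \<in> {1..n}; j \<in> {1..n}\<rbrakk> \<Longrightarrow>
        b' (i, j) \<in> generated_star_algebra A B \<and> \<phi> (b' (i, j)) = 0"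
    and m: "m \<in> carrier (mat_alg n complex_alg)" "mat_state n (\<lambda>x. x) m = 0"
    and eq: "b = b' \<oplus>\<^bsub>mat_alg n A\<^esub> scalar_mat n A m"
    using generated_MB_split[OF b] by metis
  have "b' \<in> b_leading"
    by (intro b_leading.span CollectI conjI ballI A.alternating_span_letter[OF BV_carrier])
      (use b' in auto)
  then show ?thesis
    by (simp only: eq b_leading.add b_leading.scalar m)
qed

lemma v_in_v_leading:
  assumes x: "x \<in> generated_star_algebra (mat_alg n A) {v}" "mat_state n \<phi> x = 0"
  shows "x \<in> v_leading"
proof -
  have "x \<otimes>\<^bsub>mat_alg n A\<^esub> scalar_mat n A \<one>\<^bsub>mat_alg n complex_alg\<^esub> \<in> v_leading"
    by (intro v_leading.run_scalar runs.single x
        star_algebra.one_closed[OF star_algebra.star_algebra_mat_alg[OF star_algebra_complex_alg]])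
  then show ?thesis
    by (simp only: A.scalar_mat_one M.r_one runs_closed[OF runs.single[OF x]])
qed

lemma word_leading:
  assumes "ws \<in> alternating_words (mat_alg n A) (mat_state n \<phi>) {v} MB"
  shows "alg_prod (mat_alg n A) (map snd ws) \<in> (if fst (hd ws) then b_leading else v_leading)"
  using assms
proof (induction ws)
  case Nil
  then show ?case by (simp add: alternating_words_def)
next
  case (Cons p ws)
  obtain b y where p: "p = (b, y)" by (cases p)
  have y: "y \<in> generated_star_algebra (mat_alg n A) (if b then MB else {v})" "mat_state n \<phi> y = 0"
    using Cons.prems by (auto simp: alternating_words_def p)
  have first: "y \<in> (if b then b_leading else v_leading)"
    using y b_in_b_leading v_in_v_leading by auto
  then have yc: "y \<in> carrier (mat_alg n A)"
    using b_leading_closed v_leading_span by (auto split: if_splits)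
  show ?case
  proof (cases "ws = []")
    case True
    then show ?thesis using first yc by (simp add: p)
  next
    case False
    then have "ws \<in> alternating_words (mat_alg n A) (mat_state n \<phi>) {v} MB" "fst (hd ws) = (\<not> b)"
      using Cons.prems by (auto simp: alternating_words_def p distinct_adj_Cons hd_map)
    with Cons.IH have "alg_prod (mat_alg n A) (map snd ws) \<in> (if b then v_leading else b_leading)"
      by (simp split: if_splits)
    then show ?thesis
      using y b_times_v_leading v_times_b_leading by (auto simp: p split: if_splits)
  qed
qed

lemma v_free_from_matrices: "star_free (mat_alg n A) (mat_state n \<phi>) {v} MB"
  unfolding star_free_iff_words
proof
  fix ws assume "ws \<in> alternating_words (mat_alg n A) (mat_state n \<phi>) {v} MB"
  from word_leading[OF this]
  consider "alg_prod (mat_alg n A) (map snd ws) \<in> b_leading"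
    | "alg_prod (mat_alg n A) (map snd ws) \<in> v_leading"
    by (auto split: if_splits)
  then show "mat_state n \<phi> (alg_prod (mat_alg n A) (map snd ws)) = 0"
  proof cases
    case 1
    then show ?thesis by (rule b_leading_state)
  next
    case 2
    then show ?thesis using v_leading_state(2) by (simp add: mat_state_def)
  qed
qed

end

theorem theorem17:
  fixes n :: nat
    and C :: "'c cstar_algebra" and \<iota> :: "(nat \<times> nat \<Rightarrow> complex) \<Rightarrow> 'c"
    and \<kappa> :: "(complex \<Rightarrow> complex) \<Rightarrow> 'c" and \<phi>\<^sub>n :: "'c \<Rightarrow> complex"
    and A :: "'a star_algebra" and \<phi> :: "'a \<Rightarrow> complex"
    and v :: "nat \<times> nat \<Rightarrow> 'a" and B :: "'a set"
  assumes "n \<ge> 1"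
    and "cstar_free_product (mat_alg n complex_alg) circle_alg C \<iota> \<kappa>"
    and "free_product_state (mat_alg n complex_alg) (mat_state n (\<lambda>x. x))
           circle_alg circle_state C \<iota> \<kappa> \<phi>\<^sub>n"
    and "star_prob_space A \<phi>"
    and "star_distribution A \<phi> (mat_indices n) v =
           star_distribution (brown_algebra n C \<iota>) (brown_state n \<phi>\<^sub>n) (mat_indices n)
             (brown_generator n C \<iota> \<kappa>)"
    and "v \<in> unitary_elements (mat_alg n A)"
    and "star_subalgebra B A"
    and "star_free A \<phi> B (v ` mat_indices n)"
  shows "star_free (mat_alg n A) (mat_state n \<phi>) {v} (carrier (mat_alg n (A\<lparr>carrier := B\<rparr>)))"
proof -
  have hom: "\<iota> \<in> star_hom (mat_alg n complex_alg) C" "\<kappa> \<in> star_hom circle_alg C"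
    using assms(2) by (simp_all add: cstar_free_product_def)
  have C: "star_prob_space C \<phi>\<^sub>n"
    and trace: "\<forall>m\<in>carrier (mat_alg n complex_alg). \<phi>\<^sub>n (\<iota> m) = mat_state n (\<lambda>x. x) m"
    and free: "star_free C \<phi>\<^sub>n (\<iota> ` carrier (mat_alg n complex_alg)) (\<kappa> ` carrier circle_alg)"
    using assms(3) by (simp_all add: free_product_state_def)
  interpret C: star_prob_space C \<phi>\<^sub>n by (rule C)
  interpret A: star_prob_space A \<phi> by (rule assms(4))
  have "circle_id \<in> carrier circle_alg"
    using continuous_on_id[of circle]
    by (auto simp: circle_alg_def circle_id_def cong: continuous_on_cong_simp)
  moreover have "\<kappa> ` carrier circle_alg \<subseteq> carrier C"
    using hom(2) by (auto simp: star_hom_def ring_hom_def)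
  moreover have "v \<in> carrier (mat_alg n A)"
    using assms(6) by (simp add: unitary_elements_def)
  moreover have "star_distribution A \<phi> (mat_indices n) v =
      star_distribution (corner C (\<iota> (mat_unit n complex_alg 1 1))) (\<lambda>x. of_nat n * \<phi>\<^sub>n x) (mat_indices n)
        (\<lambda>(i, j). \<iota> (mat_unit n complex_alg 1 i) \<otimes>\<^bsub>C\<^esub> \<kappa> circle_id \<otimes>\<^bsub>C\<^esub> \<iota> (mat_unit n complex_alg j 1))"
    using assms(5) unfolding brown_algebra_def brown_state_def[abs_def] brown_generator_def .
  ultimately have "brown_copy_free C n \<iota> \<phi>\<^sub>n A \<phi> (\<kappa> ` carrier circle_alg) (\<kappa> circle_id) v B"
    using assms(1,7,8) hom(1) trace free
    by unfold_locales auto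
  then show ?thesis
    by (rule brown_copy_free.v_free_from_matrices)
qed

end
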